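(* Let $E$ be a spectral measure on $(\Omega,\mathscr A)$, $J$ an imaginary operator associated with $E$, and $\mathfrak I\in\mathbb S$. For any bounded $\mathscr A$-measurable functions $f,g:\Omega\to\mathbb C_{\mathfrak I}$, we have the following: (i) $\mathbb I(\bar f)=\mathbb I(f)^*$. (ii) $\mathbb I(fg)=\mathbb I(f)\mathbb I(g)$. (iii) $\mathbb I(\mathfrak I)=J$ and $\mathbb I(cf+g)=(\mathrm{Re}(c)I+\mathrm{Im}(c)J)\,\mathbb I(f)+\mathbb I(g)$ for all $c\in\mathbb C_{\mathfrak I}$. (iv) $\langle\mathbb I(f)x,y\rangle=\int_\Omega\mathrm{Re}(f(\lambda))\,d\langle E(\lambda)x,y\rangle+\int_\Omega\mathrm{Im}(f(\lambda))\,d\langle JE(\lambda)x,y\rangle$ for all $x,y\in\mathcal H_n$. (v) $\|\mathbb I(f)x\|^2=\int_\Omega|f(\lambda)|^2\,d(\mathrm{Re}\langle E(\lambda)x,x\rangle)$ for all $x\in\mathcal H_n$. (vi) $\|\mathbb I(f)\|\le\|f\|_\infty$. (vii) For any sequence of bounded $\mathscr A$-measurable functions $f_j:\Omega\to\mathbb C_{\mathfrak I}$, $j=1,2,\dots$, which converges pointwise $E$-a.e. on $\Omega$ to $f$ and for which there exists $\kappa>0$ with $|f_j(\lambda)|\le\kappa$ for all $\lambda\in\Omega$ and $j=1,2,\dots$, the operators $\mathbb I(f_j)$ converge to $\mathbb I(f)$ in the strong operator topology.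
   Context: Let $n\ge1$. $\mathbb R_n$ is the real Clifford algebra (of real dimension $2^n$) generated by $e_1,\dots,e_n$ with $e_i^2=-1$ and $e_ie_j=-e_je_i$ for $i\ne j$; it has basis $e_\alpha=e_{i_1}\cdots e_{i_r}$ for $\alpha=\{i_1<\cdots<i_r\}\subseteq\{1,\dots,n\}$, $e_\emptyset=1$. For $a=\sum_\alpha a_\alpha e_\alpha$ ($a_\alpha\in\mathbb R$): $\mathrm{Re}(a)=a_\emptyset$, $|a|=(\sum_\alpha a_\alpha^2)^{1/2}$, and $a\mapsto\bar a$ is the real-linear map with $\overline{ab}=\bar b\,\bar a$, $\bar 1=1$, $\bar e_j=-e_j$. $\mathcal H$ is a real Hilbert space and $\mathcal H_n=\mathcal H\otimes\mathbb R_n$ is the two-sided Clifford module of elements $x=\sum_\alpha x_\alpha e_\alpha$ ($x_\alpha\in\mathcal H$), with $\langle x,y\rangle=\sum_{\alpha,\beta}\bar e_\beta e_\alpha\langle x_\alpha,y_\beta\rangle_{\mathcal H}\in\mathbb R_n$ (so $\langle xa,y\rangle=\langle x,y\rangle a$) and norm $\|x\|=(\sum_\alpha\|x_\alpha\|^2)^{1/2}=(\mathrm{Re}\langle x,x\rangle)^{1/2}$. $\mathcal B(\mathcal H_n)$ is the set of everywhere defined bounded right $\mathbb R_n$-linear operators on $\mathcal H_n$; $T^*$ is the adjoint. An imaginary operator is a unitary $J\in\mathcal B(\mathcal H_n)$ with $J^*=-J$. An orthogonal projection is a self-adjoint $P\in\mathcal B(\mathcal H_n)$ with $P^2=P$.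 $\mathbb S=\{\sum_{j=1}^n\mathfrak I_je_j:\sum\mathfrak I_j^2=1\}$ (so $\mathfrak I^2=-1$). For $\mathfrak I\in\mathbb S$, $\mathbb C_{\mathfrak I}=\{\lambda_0+\lambda_1\mathfrak I:\lambda_0,\lambda_1\in\mathbb R\}$, $\mathrm{Re}(\lambda)=\lambda_0$, $\mathrm{Im}(\lambda)=\lambda_1\in\mathbb R$. A spectral measure on a $\sigma$-algebra $\mathscr A$ of subsets of $\Omega$ is a map $E$ from $\mathscr A$ to orthogonal projections on $\mathcal H_n$ that is countably additive (in the strong operator topology) with $E(\Omega)=I$. $J$ is associated with $E$ if $JE(M)=E(M)J$ for all $M\in\mathscr A$. For a simple function $f=\sum_jc_j\chi_{M_j}$ (disjoint $M_j\in\mathscr A$, $c_j\in\mathbb C_{\mathfrak I}$), $\mathbb I(f)=\sum_j\{\mathrm{Re}(c_j)E(M_j)+\mathrm{Im}(c_j)E(M_j)J\}$; for bounded measurable $f:\Omega\to\mathbb C_{\mathfrak I}$, $\mathbb I(f)\in\mathcal B(\mathcal H_n)$ is the operator norm limit of $\mathbb I(f_j)$ for simple $f_j\to f$ uniformly. $\|f\|_\infty=\sup_{\lambda\in\Omega}|f(\lambda)|$. Integrals of real functions against $\mathbb R_n$-valued measures are defined componentwise in the basis $e_\alpha$. *)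

theory Defs
  imports "HOL-Analysis.Analysis"
begin

section \<open>The real Clifford algebra\<close>

text \<open>
  The index set \<open>{1, ..., n}\<close>, \<open>n \<ge> 1\<close>, is rendered by a finite linearly ordered type \<open>'n\<close>
  (\<open>n = CARD('n)\<close>; types are nonempty). An element \<open>\<Sum>\<^sub>\<alpha> a\<^sub>\<alpha> e\<^sub>\<alpha>\<close> is given by its coefficients
  \<open>a\<^sub>\<alpha>\<close>, \<open>\<alpha> \<subseteq> {1, ..., n}\<close>.
\<close>

typedef 'n clifford = "UNIV :: ('n set \<Rightarrow> real) set"
  morphisms coeff Clifford ..

lemma coeff_Clifford [simp]: "coeff (Clifford f) = f"
  by (simp add: Clifford_inverse)

lemma clifford_eqI: "(\<And>\<alpha>. coeff a \<alpha> = coeff b \<alpha>) \<Longrightarrow> a = b"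
  by (metis coeff_inject ext)

lemma clifford_eq_iff: "a = b \<longleftrightarrow> (\<forall>\<alpha>. coeff a \<alpha> = coeff b \<alpha>)"
  by (metis clifford_eqI)

instantiation clifford :: (finite) real_vector
begin
definition "0 = Clifford (\<lambda>_. 0)"
definition "a + b = Clifford (\<lambda>\<alpha>. coeff a \<alpha> + coeff b \<alpha>)"
definition "a - b = Clifford (\<lambda>\<alpha>. coeff a \<alpha> - coeff b \<alpha>)"
definition "- a = Clifford (\<lambda>\<alpha>. - coeff a \<alpha>)"
definition "r *\<^sub>R a = Clifford (\<lambda>\<alpha>. r * coeff a \<alpha>)"
instance
  by standard
    (simp_all add: zero_clifford_def plus_clifford_def minus_clifford_def uminus_clifford_def
      scaleR_clifford_def clifford_eq_iff algebra_simps)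
end

lemma coeff_simps [simp]:
  "coeff 0 \<alpha> = 0" "coeff (a + b) \<alpha> = coeff a \<alpha> + coeff b \<alpha>"
  "coeff (a - b) \<alpha> = coeff a \<alpha> - coeff b \<alpha>" "coeff (- a) \<alpha> = - coeff a \<alpha>"
  "coeff (r *\<^sub>R a) \<alpha> = r * coeff a \<alpha>"
  by (simp_all add: zero_clifford_def plus_clifford_def minus_clifford_def uminus_clifford_def
      scaleR_clifford_def)

lemma coeff_sum [simp]: "coeff (sum f A) \<alpha> = (\<Sum>i\<in>A. coeff (f i) \<alpha>)"
  by (induction A rule: infinite_finite_induct) auto

definition basis_elem :: "'n set \<Rightarrow> 'n clifford"
  where "basis_elem \<alpha> = Clifford (\<lambda>\<beta>. if \<beta> = \<alpha> then 1 else 0)"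

abbreviation gen :: "'n \<Rightarrow> 'n clifford"
  where "gen i \<equiv> basis_elem {i}"

lemma coeff_basis_elem [simp]: "coeff (basis_elem \<alpha>) \<beta> = (if \<beta> = \<alpha> then 1 else 0)"
  by (simp add: basis_elem_def)

lemma clifford_expansion:
  fixes a :: "'n::finite clifford"
  shows "a = (\<Sum>\<alpha>\<in>UNIV. coeff a \<alpha> *\<^sub>R basis_elem \<alpha>)"
  by (rule clifford_eqI) (simp add: if_distrib cong: if_cong)

text \<open>The Euclidean structure, so that \<open>norm a = (\<Sum>\<^sub>\<alpha> a\<^sub>\<alpha>\<^sup>2)\<^sup>1\<^sup>/\<^sup>2\<close>.\<close>

instantiation clifford :: (finite) euclidean_space
begin
definition "inner a b = (\<Sum>\<alpha>\<in>UNIV. coeff a \<alpha> * coeff b \<alpha>)"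
definition "norm (a :: 'a clifford) = sqrt (inner a a)"
definition "sgn (a :: 'a clifford) = a /\<^sub>R norm a"
definition "dist (a :: 'a clifford) b = norm (a - b)"
definition "(uniformity :: ('a clifford \<times> 'a clifford) filter)
  = (INF e\<in>{0 <..}. principal {(x, y). dist x y < e})"
definition "open (U :: 'a clifford set)
  \<longleftrightarrow> (\<forall>x\<in>U. eventually (\<lambda>(x', y). x' = x \<longrightarrow> y \<in> U) uniformity)"
definition "(Basis :: 'a clifford set) = range basis_elem"
instance
proof
  fix a b c :: "'a clifford" and r :: real
  show "inner a b = inner b a" "inner (a + b) c = inner a c + inner b c"
    "inner (r *\<^sub>R a) b = r * inner a b" "0 \<le> inner a a"
    by (simp_all add: inner_clifford_def algebra_simps sum.distrib sum_distrib_left sum_nonneg)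
  show "inner a a = 0 \<longleftrightarrow> a = 0"
    by (simp add: inner_clifford_def sum_nonneg_eq_0_iff clifford_eq_iff)
  show "(Basis :: 'a clifford set) \<noteq> {}" "finite (Basis :: 'a clifford set)"
    by (simp_all add: Basis_clifford_def)
  show "(\<forall>u\<in>Basis. inner a u = 0) \<longleftrightarrow> a = 0"
    by (simp add: Basis_clifford_def inner_clifford_def clifford_eq_iff if_distrib cong: if_cong)
next
  fix u v :: "'a clifford"
  assume "u \<in> Basis" "v \<in> Basis"
  then show "inner u v = (if u = v then 1 else 0)"
    by (auto simp: Basis_clifford_def inner_clifford_def basis_elem_def Clifford_inject fun_eq_iff
        if_distrib[of "\<lambda>x. x * _"] if_distrib[of "\<lambda>x. _ * x"] cong: if_cong)
qed (simp_all add: norm_clifford_def sgn_clifford_def dist_clifford_def uniformity_clifford_def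
       open_clifford_def)
end

text \<open>
  \<open>e\<^sub>\<alpha> e\<^sub>\<beta> = reorder_sign \<alpha> \<beta> e\<^sub>\<gamma>\<close>, where \<open>\<gamma>\<close> is the symmetric difference of \<open>\<alpha>\<close> and \<open>\<beta>\<close>: a factor
  \<open>-1\<close> arises from moving \<open>e\<^sub>j\<close>, \<open>j \<in> \<beta>\<close>, past each \<open>e\<^sub>i\<close>, \<open>i \<in> \<alpha>\<close>, \<open>i > j\<close>, and from each
  \<open>e\<^sub>j\<^sup>2 = -1\<close> with \<open>j \<in> \<alpha> \<inter> \<beta>\<close>.
\<close>

definition reorder_sign :: "'n::linorder set \<Rightarrow> 'n set \<Rightarrow> real"
  where "reorder_sign \<alpha> \<beta> = (\<Prod>i\<in>\<alpha>. \<Prod>j\<in>\<beta>. if j \<le> i then -1 else 1)"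

lemma prod_sym_diff:
  fixes f :: "'a \<Rightarrow> real"
  assumes "finite A" "finite B" "\<And>i. f i * f i = 1"
  shows "prod f (sym_diff A B) = prod f A * prod f B"
proof -
  have A: "prod f A = prod f (A - B) * prod f (A \<inter> B)"
    using prod.Int_Diff[OF assms(1), of f B] by (simp add: mult.commute)
  have B: "prod f B = prod f (B - A) * prod f (A \<inter> B)"
    using prod.Int_Diff[OF assms(2), of f A] by (simp add: mult.commute Int_commute)
  have "prod f (sym_diff A B) = prod f (A - B) * prod f (B - A)"
    using assms(1,2) by (intro prod.union_disjoint) auto
  moreover have "prod f (A \<inter> B) * prod f (A \<inter> B) = 1"
    using assms(3) by (simp flip: prod.distrib)
  ultimately show ?thesis
    by (simp add: A B algebra_simps)
qed

lemma reorder_sign_square [simp]: "reorder_sign \<alpha> \<beta> * reorder_sign \<alpha> \<beta> = 1"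
  unfolding reorder_sign_def
  by (subst prod.distrib[symmetric], rule prod.neutral, rule ballI,
      subst prod.distrib[symmetric], rule prod.neutral) auto

lemma reorder_sign_empty [simp]: "reorder_sign {} \<beta> = 1" "reorder_sign \<alpha> {} = 1"
  by (simp_all add: reorder_sign_def)

lemma reorder_sign_sym_diff_left:
  fixes \<alpha> \<beta> \<gamma> :: "'n::{finite,linorder} set"
  shows "reorder_sign (sym_diff \<alpha> \<beta>) \<gamma> = reorder_sign \<alpha> \<gamma> * reorder_sign \<beta> \<gamma>"
  unfolding reorder_sign_def
  by (rule prod_sym_diff) (auto simp flip: prod.distrib intro!: prod.neutral)

lemma reorder_sign_swap:
  "reorder_sign \<alpha> \<beta> = (\<Prod>j\<in>\<beta>. \<Prod>i\<in>\<alpha>. if j \<le> i then -1 else 1)"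
  unfolding reorder_sign_def by (rule prod.swap)

lemma reorder_sign_sym_diff_right:
  fixes \<alpha> \<beta> \<gamma> :: "'n::{finite,linorder} set"
  shows "reorder_sign \<gamma> (sym_diff \<alpha> \<beta>) = reorder_sign \<gamma> \<alpha> * reorder_sign \<gamma> \<beta>"
  unfolding reorder_sign_swap
  by (rule prod_sym_diff) (auto simp flip: prod.distrib intro!: prod.neutral)

lemma sym_diff_cancel: "sym_diff \<alpha> (sym_diff \<alpha> \<beta>) = \<beta>"
  by auto

lemma sum_sym_diff:
  fixes f :: "'n::finite set \<Rightarrow> 'b::comm_monoid_add"
  shows "(\<Sum>\<beta>\<in>UNIV. f (sym_diff \<alpha> \<beta>)) = (\<Sum>\<beta>\<in>UNIV. f \<beta>)"
  by (rule sum.reindex_bij_witness[of _ "sym_diff \<alpha>" "sym_diff \<alpha>"]) (auto simp: sym_diff_cancel)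

instantiation clifford :: ("{finite,linorder}") real_algebra_1
begin
definition "1 = (basis_elem {} :: 'a clifford)"
definition "a * b = (\<Sum>\<alpha>\<in>UNIV. \<Sum>\<beta>\<in>UNIV.
  (coeff a \<alpha> * coeff b \<beta> * reorder_sign \<alpha> \<beta>) *\<^sub>R basis_elem (sym_diff \<alpha> \<beta>))"

lemma coeff_mult:
  fixes a b :: "'a clifford"
  shows "coeff (a * b) \<gamma> =
    (\<Sum>\<alpha>\<in>UNIV. coeff a \<alpha> * coeff b (sym_diff \<alpha> \<gamma>) * reorder_sign \<alpha> (sym_diff \<alpha> \<gamma>))"
proof -
  have "(\<Sum>\<beta>\<in>UNIV. coeff a \<alpha> * coeff b \<beta> * reorder_sign \<alpha> \<beta>
            * (if \<gamma> = sym_diff \<alpha> \<beta> then 1 else 0))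
        = coeff a \<alpha> * coeff b (sym_diff \<alpha> \<gamma>) * reorder_sign \<alpha> (sym_diff \<alpha> \<gamma>)" for \<alpha>
    by (subst sum_sym_diff[of _ \<alpha>, symmetric])
       (simp only: sym_diff_cancel if_distrib[of "\<lambda>x. _ * x"] mult_1_right mult_zero_right
          sum.delta' sum.delta finite UNIV_I if_True)
  then show ?thesis
    by (simp only: times_clifford_def coeff_sum coeff_simps coeff_basis_elem)
qed

lemma mult_assoc_clifford:
  fixes a b c :: "'a clifford"
  shows "a * b * c = a * (b * c)"
proof (rule clifford_eqI)
  fix \<gamma> :: "'a set"
  have sign: "reorder_sign \<alpha> (sym_diff \<alpha> (sym_diff \<alpha> \<beta>))
      * reorder_sign (sym_diff \<alpha> \<beta>) (sym_diff (sym_diff \<alpha> \<beta>) \<gamma>)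
      = reorder_sign \<beta> (sym_diff \<beta> (sym_diff \<alpha> \<gamma>)) * reorder_sign \<alpha> (sym_diff \<alpha> \<gamma>)"
    for \<alpha> \<beta> :: "'a set"
  proof -
    define \<tau> where "\<tau> = sym_diff (sym_diff \<alpha> \<beta>) \<gamma>"
    have eq: "sym_diff \<beta> (sym_diff \<alpha> \<gamma>) = \<tau>" "sym_diff \<alpha> \<gamma> = sym_diff \<beta> \<tau>"
      unfolding \<tau>_def by blast+
    show ?thesis
      unfolding sym_diff_cancel eq(1) \<tau>_def[symmetric] unfolding eq(2)
      unfolding reorder_sign_sym_diff_left reorder_sign_sym_diff_right by simp
  qed
  have set_eq: "sym_diff (sym_diff \<alpha> \<beta>) \<gamma> = sym_diff \<beta> (sym_diff \<alpha> \<gamma>)" for \<alpha> \<beta> :: "'a set"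
    by blast
  have "coeff (a * b * c) \<gamma> = (\<Sum>\<delta>\<in>UNIV. \<Sum>\<alpha>\<in>UNIV.
      coeff a \<alpha> * coeff b (sym_diff \<alpha> \<delta>) * reorder_sign \<alpha> (sym_diff \<alpha> \<delta>)
      * coeff c (sym_diff \<delta> \<gamma>) * reorder_sign \<delta> (sym_diff \<delta> \<gamma>))"
    by (simp only: coeff_mult sum_distrib_right)
  also have "\<dots> = (\<Sum>\<alpha>\<in>UNIV. \<Sum>\<delta>\<in>UNIV.
      coeff a \<alpha> * coeff b (sym_diff \<alpha> \<delta>) * reorder_sign \<alpha> (sym_diff \<alpha> \<delta>)
      * coeff c (sym_diff \<delta> \<gamma>) * reorder_sign \<delta> (sym_diff \<delta> \<gamma>))"
    by (rule sum.swap)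
  also have "\<dots> = (\<Sum>\<alpha>\<in>UNIV. \<Sum>\<beta>\<in>UNIV.
      coeff a \<alpha> * coeff b \<beta> * coeff c (sym_diff (sym_diff \<alpha> \<beta>) \<gamma>)
      * (reorder_sign \<alpha> (sym_diff \<alpha> (sym_diff \<alpha> \<beta>))
         * reorder_sign (sym_diff \<alpha> \<beta>) (sym_diff (sym_diff \<alpha> \<beta>) \<gamma>)))"
  proof (rule sum.cong[OF refl])
    fix \<alpha> :: "'a set"
    show "(\<Sum>\<delta>\<in>UNIV. coeff a \<alpha> * coeff b (sym_diff \<alpha> \<delta>) * reorder_sign \<alpha> (sym_diff \<alpha> \<delta>)
        * coeff c (sym_diff \<delta> \<gamma>) * reorder_sign \<delta> (sym_diff \<delta> \<gamma>))
      = (\<Sum>\<beta>\<in>UNIV. coeff a \<alpha> * coeff b \<beta> * coeff c (sym_diff (sym_diff \<alpha> \<beta>) \<gamma>)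
      * (reorder_sign \<alpha> (sym_diff \<alpha> (sym_diff \<alpha> \<beta>))
         * reorder_sign (sym_diff \<alpha> \<beta>) (sym_diff (sym_diff \<alpha> \<beta>) \<gamma>)))"
      by (subst sum_sym_diff[of _ \<alpha>, symmetric])
         (simp only: sym_diff_cancel mult.assoc mult.left_commute mult.commute)
  qed
  also have "\<dots> = (\<Sum>\<alpha>\<in>UNIV. \<Sum>\<beta>\<in>UNIV.
      coeff a \<alpha> * (coeff b \<beta> * coeff c (sym_diff \<beta> (sym_diff \<alpha> \<gamma>))
        * reorder_sign \<beta> (sym_diff \<beta> (sym_diff \<alpha> \<gamma>))) * reorder_sign \<alpha> (sym_diff \<alpha> \<gamma>))"
    unfolding sign unfolding set_eq by (simp only: mult.assoc)
  also have "\<dots> = coeff (a * (b * c)) \<gamma>"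
    by (simp only: coeff_mult sum_distrib_right sum_distrib_left)
  finally show "coeff (a * b * c) \<gamma> = coeff (a * (b * c)) \<gamma>" .
qed

lemma basis_elem_mult:
  "basis_elem \<alpha> * basis_elem \<beta> = reorder_sign \<alpha> \<beta> *\<^sub>R (basis_elem (sym_diff \<alpha> \<beta>) :: 'a clifford)"
  by (simp add: times_clifford_def if_distrib[of "\<lambda>x. x * _"] if_distrib[of "\<lambda>x. _ * x"]
      if_distrib[of "\<lambda>x. x *\<^sub>R _"] cong: if_cong)

instance
proof
  fix a b c :: "'a clifford" and r :: real
  show "a * b * c = a * (b * c)"
    by (rule mult_assoc_clifford)
  show "(a + b) * c = a * c + b * c" "a * (b + c) = a * b + a * c"
    "r *\<^sub>R a * b = r *\<^sub>R (a * b)" "a * r *\<^sub>R b = r *\<^sub>R (a * b)"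
    by (simp_all only: clifford_eq_iff coeff_mult coeff_simps)
       (simp_all add: algebra_simps sum.distrib sum_distrib_left)
  show "1 * a = a"
    by (simp add: clifford_eq_iff coeff_mult one_clifford_def if_distrib[of "\<lambda>x. x * _"] cong: if_cong)
  show "a * 1 = a"
  proof (rule clifford_eqI)
    fix \<gamma> :: "'a set"
    have "sym_diff \<alpha> \<gamma> = {} \<longleftrightarrow> \<alpha> = \<gamma>" for \<alpha>
      by blast
    then have "coeff (a * 1) \<gamma> = (\<Sum>\<alpha>\<in>UNIV. if \<alpha> = \<gamma> then coeff a \<alpha> else 0)"
      unfolding coeff_mult one_clifford_def coeff_basis_elem
      by (intro sum.cong refl) auto
    then show "coeff (a * 1) \<gamma> = coeff a \<gamma>"
      by simp
  qed
  show "(0 :: 'a clifford) \<noteq> 1"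
    by (auto simp: clifford_eq_iff one_clifford_def)
qed
end

lemma gen_square: "gen i * gen i = (-1 :: 'n::{finite,linorder} clifford)"
  by (simp add: basis_elem_mult reorder_sign_def one_clifford_def)

lemma gen_anticommute:
  fixes i j :: "'n::{finite,linorder}"
  assumes "i \<noteq> j"
  shows "gen i * gen j = - (gen j * gen i)"
proof -
  have "sym_diff {i} {j} = sym_diff {j} {i}"
    by blast
  with assms show ?thesis
    by (auto simp: basis_elem_mult reorder_sign_def clifford_eq_iff)
qed

lemma basis_elem_eq_prod_gen:
  fixes xs :: "'n::{finite,linorder} list"
  assumes "sorted_wrt (<) xs"
  shows "basis_elem (set xs) = prod_list (map gen xs)"
  using assms
proof (induction xs)
  case Nil
  then show ?case by (simp add: one_clifford_def)
next
  case (Cons x xs)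
  have "reorder_sign {x} (set xs) = 1"
    using Cons.prems by (auto simp: reorder_sign_def intro!: prod.neutral)
  moreover have "sym_diff {x} (set xs) = set (x # xs)"
    using Cons.prems by auto
  ultimately show ?case
    using Cons by (simp add: basis_elem_mult flip: Cons.IH)
qed

definition cre :: "'n clifford \<Rightarrow> real"
  where "cre a = coeff a {}"

text \<open>
  Reversing a product of \<open>r\<close> distinct generators and changing their signs gives the factor
  \<open>(-1)\<^sup>r\<^sup>(\<^sup>r\<^sup>+\<^sup>1\<^sup>)\<^sup>/\<^sup>2\<close>. The lemmas below are the defining properties of the conjugation.
\<close>

definition cconj :: "'n clifford \<Rightarrow> 'n clifford"
  where "cconj a = Clifford (\<lambda>\<alpha>. (-1) ^ (card \<alpha> * (card \<alpha> + 1) div 2) * coeff a \<alpha>)"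

lemma reorder_sign_self:
  fixes \<alpha> :: "'n::{finite,linorder} set"
  shows "reorder_sign \<alpha> \<alpha> = (-1) ^ (card \<alpha> * (card \<alpha> + 1) div 2)"
proof (induction \<alpha> rule: finite_linorder_max_induct[OF finite])
  case 1
  then show ?case by simp
next
  case (2 b A)
  then have b: "b \<notin> A" "finite A"
    by auto
  have "reorder_sign (insert b A) (insert b A) = (-1) ^ Suc (card A) * reorder_sign A A"
  proof -
    have "(\<Prod>j\<in>insert b A. if j \<le> b then -1 else (1::real)) = (\<Prod>j\<in>insert b A. -1)"
      using 2 by (intro prod.cong) auto
    moreover have "(\<Prod>i\<in>A. \<Prod>j\<in>insert b A. if j \<le> i then -1 else (1::real))
        = (\<Prod>i\<in>A. \<Prod>j\<in>A. if j \<le> i then -1 else 1)"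
    proof (rule prod.cong[OF refl])
      fix i
      assume "i \<in> A"
      then have "\<not> b \<le> i"
        using 2 by auto
      then show "(\<Prod>j\<in>insert b A. if j \<le> i then -1 else (1::real))
          = (\<Prod>j\<in>A. if j \<le> i then -1 else 1)"
        using b by simp
    qed
    ultimately show ?thesis
      unfolding reorder_sign_def by (subst prod.insert[OF b(2,1)]) (simp add: b)
  qed
  moreover have "Suc (card A) * (Suc (card A) + 1) div 2 = Suc (card A) + card A * (card A + 1) div 2"
  proof -
    have "Suc (card A) * (Suc (card A) + 1) = Suc (card A) * 2 + card A * (card A + 1)"
      by (simp add: algebra_simps)
    then show ?thesis
      by simp
  qed
  ultimately show ?case
    using 2 by (simp only: card_insert_disjoint[OF b(2,1)] power_add)
qed

lemma coeff_cconj: "coeff (cconj a) \<alpha> = reorder_sign \<alpha> \<alpha> * coeff a \<alpha>"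
  for a :: "'n::{finite,linorder} clifford"
  by (simp add: cconj_def reorder_sign_self)

lemma cconj_linear: "cconj (a + b) = cconj a + cconj b" "cconj (r *\<^sub>R a) = r *\<^sub>R cconj a"
  for a b :: "'n::{finite,linorder} clifford"
  by (simp_all add: clifford_eq_iff coeff_cconj algebra_simps)

lemma cconj_one: "cconj 1 = (1 :: 'n::{finite,linorder} clifford)"
  by (simp add: clifford_eq_iff coeff_cconj one_clifford_def)

lemma cconj_gen: "cconj (gen i) = - gen i"
  for i :: "'n::{finite,linorder}"
  by (simp add: clifford_eq_iff coeff_cconj reorder_sign_def)

lemma cconj_mult: "cconj (a * b) = cconj b * cconj a"
  for a b :: "'n::{finite,linorder} clifford"
proof (rule clifford_eqI)
  fix \<gamma> :: "'n set"
  have sign: "reorder_sign \<gamma> \<gamma> * reorder_sign (sym_diff \<gamma> \<beta>) (sym_diff (sym_diff \<gamma> \<beta>) \<gamma>)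
      = reorder_sign \<beta> \<beta> * reorder_sign (sym_diff \<gamma> \<beta>) (sym_diff \<gamma> \<beta>)
        * reorder_sign \<beta> (sym_diff \<beta> \<gamma>)" for \<beta> :: "'n set"
  proof -
    have eq: "sym_diff (sym_diff \<gamma> \<beta>) \<gamma> = \<beta>"
      by blast
    show ?thesis
      unfolding eq unfolding reorder_sign_sym_diff_left reorder_sign_sym_diff_right
      using reorder_sign_square[of \<beta> \<beta>] reorder_sign_square[of \<beta> \<gamma>] by algebra
  qed
  have eq: "sym_diff (sym_diff \<gamma> \<beta>) \<gamma> = \<beta>" "sym_diff \<beta> \<gamma> = sym_diff \<gamma> \<beta>" for \<beta> :: "'n set"
    by blast+
  have coeff_eq: "coeff c (sym_diff \<beta> \<gamma>) = coeff c (sym_diff \<gamma> \<beta>)"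
    "reorder_sign (sym_diff \<gamma> \<beta>) (sym_diff \<beta> \<gamma>) = reorder_sign (sym_diff \<gamma> \<beta>) (sym_diff \<gamma> \<beta>)"
    "reorder_sign \<beta> (sym_diff \<beta> \<gamma>) = reorder_sign \<beta> (sym_diff \<gamma> \<beta>)"
    "reorder_sign (sym_diff \<beta> \<gamma>) (sym_diff \<beta> \<gamma>) = reorder_sign (sym_diff \<gamma> \<beta>) (sym_diff \<gamma> \<beta>)"
    for \<beta> :: "'n set" and c :: "'n clifford"
    by (simp_all only: eq(2)[of \<beta>])
  have "coeff (cconj (a * b)) \<gamma> = (\<Sum>\<beta>\<in>UNIV. coeff a (sym_diff \<gamma> \<beta>)
      * coeff b (sym_diff (sym_diff \<gamma> \<beta>) \<gamma>)
      * (reorder_sign \<gamma> \<gamma> * reorder_sign (sym_diff \<gamma> \<beta>) (sym_diff (sym_diff \<gamma> \<beta>) \<gamma>)))"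
    unfolding coeff_cconj coeff_mult
    by (subst sum_sym_diff[of _ \<gamma>, symmetric])
       (simp only: sum_distrib_left mult.assoc mult.left_commute mult.commute)
  also have "\<dots> = coeff (cconj b * cconj a) \<gamma>"
    unfolding sign unfolding coeff_cconj coeff_mult
    by (intro sum.cong refl) (simp only: eq(1) coeff_eq mult.assoc mult.left_commute mult.commute)
  finally show "coeff (cconj (a * b)) \<gamma> = coeff (cconj b * cconj a) \<gamma>" .
qed

section \<open>The Clifford module and its operators\<close>

text \<open>
  \<open>x = \<Sum>\<^sub>\<alpha> x\<^sub>\<alpha> e\<^sub>\<alpha>\<close> is the vector of its components \<open>x $ \<alpha>\<close> in the real Hilbert space \<open>'h\<close>; the
  library norm on \<open>vec\<close> is \<open>(\<Sum>\<^sub>\<alpha> \<parallel>x\<^sub>\<alpha>\<parallel>\<^sup>2)\<^sup>1\<^sup>/\<^sup>2\<close>, and \<open>\<Rightarrow>\<^sub>L\<close> carries the operator norm.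
\<close>

type_synonym ('h, 'n) cmodule = "('h, 'n set) vec"
type_synonym ('h, 'n) coperator = "('h, 'n) cmodule \<Rightarrow>\<^sub>L ('h, 'n) cmodule"

definition rmult ::
    "('h::real_vector, 'n::{finite,linorder}) cmodule \<Rightarrow> 'n clifford \<Rightarrow> ('h, 'n) cmodule"
  where "rmult x a = (\<chi> \<gamma>. \<Sum>\<alpha>\<in>UNIV. coeff (basis_elem \<alpha> * a) \<gamma> *\<^sub>R (x $ \<alpha>))"

definition cinner ::
    "('h::real_inner, 'n::{finite,linorder}) cmodule \<Rightarrow> ('h, 'n) cmodule \<Rightarrow> 'n clifford"
  where "cinner x y = (\<Sum>\<alpha>\<in>UNIV. \<Sum>\<beta>\<in>UNIV.
    ((x $ \<alpha>) \<bullet> (y $ \<beta>)) *\<^sub>R (cconj (basis_elem \<beta>) * basis_elem \<alpha>))"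

lemma cinner_rmult: "cinner (rmult x a) y = cinner x y * a"
proof -
  have "cinner x y * a = (\<Sum>\<alpha>\<in>UNIV. \<Sum>\<beta>\<in>UNIV.
      ((x $ \<alpha>) \<bullet> (y $ \<beta>)) *\<^sub>R (cconj (basis_elem \<beta>) * (basis_elem \<alpha> * a)))"
    by (simp add: cinner_def sum_distrib_right mult.assoc)
  also have "\<dots> = (\<Sum>\<alpha>\<in>UNIV. \<Sum>\<beta>\<in>UNIV. \<Sum>\<gamma>\<in>UNIV.
      (coeff (basis_elem \<alpha> * a) \<gamma> * ((x $ \<alpha>) \<bullet> (y $ \<beta>)))
        *\<^sub>R (cconj (basis_elem \<beta>) * basis_elem \<gamma>))"
    by (subst clifford_expansion[of "basis_elem _ * a"])
       (simp add: sum_distrib_left scaleR_sum_right mult.commute)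
  also have "\<dots> = (\<Sum>\<gamma>\<in>UNIV. \<Sum>\<beta>\<in>UNIV. \<Sum>\<alpha>\<in>UNIV.
      (coeff (basis_elem \<alpha> * a) \<gamma> * ((x $ \<alpha>) \<bullet> (y $ \<beta>)))
        *\<^sub>R (cconj (basis_elem \<beta>) * basis_elem \<gamma>))"
    by (subst sum.swap, subst (2) sum.swap, subst sum.swap) (rule refl)
  also have "\<dots> = cinner (rmult x a) y"
    by (simp add: cinner_def rmult_def inner_sum_left scaleR_sum_left)
  finally show ?thesis ..
qed

lemma cre_cinner: "cre (cinner x y) = x \<bullet> y"
  for x y :: "('h::real_inner, 'n::{finite,linorder}) cmodule"
proof -
  have "coeff (cconj (basis_elem \<beta>) * basis_elem \<alpha>) {} = (if \<alpha> = \<beta> then 1 else 0)"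
    for \<alpha> \<beta> :: "'n set"
    by (auto simp: coeff_mult coeff_cconj if_distrib[of "\<lambda>x. x * _"]
        if_distrib[of "\<lambda>x. _ * x"] cong: if_cong)
  then show ?thesis
    by (simp add: cinner_def inner_vec_def cre_def if_distrib[of "\<lambda>x. _ * x"] cong: if_cong)
qed

lemma norm_cmodule: "(norm x)\<^sup>2 = (\<Sum>\<alpha>\<in>UNIV. (norm (x $ \<alpha>))\<^sup>2)" "(norm x)\<^sup>2 = cre (cinner x x)"
  for x :: "('h::real_inner, 'n::{finite,linorder}) cmodule"
  by (simp_all add: norm_vec_def L2_set_def sum_nonneg)
     (simp add: cre_cinner inner_vec_def power2_norm_eq_inner)

text \<open>The bounded right linear operators; \<open>\<Rightarrow>\<^sub>L\<close> provides everywhere defined and bounded.\<close>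

definition right_linear :: "('h::real_inner, 'n::{finite,linorder}) coperator \<Rightarrow> bool"
  where "right_linear T \<longleftrightarrow> (\<forall>x a. T (rmult x a) = rmult (T x) a)"

text \<open>
  The adjoint with respect to the Clifford-valued inner product; it is unique, and it exists for
  right linear \<open>T\<close> on a Hilbert space by the Riesz representation theorem.
\<close>

definition adj :: "('h::real_inner, 'n::{finite,linorder}) coperator \<Rightarrow> ('h, 'n) coperator"
  where "adj T = (THE S. right_linear S \<and> (\<forall>x y. cinner (T x) y = cinner x (S y)))"

definition orth_projection :: "('h::real_inner, 'n::{finite,linorder}) coperator \<Rightarrow> bool"
  where "orth_projection P \<longleftrightarrow> right_linear P \<and> adj P = P \<and> P o\<^sub>L P = P"

definition unitary_op :: "('h::real_inner, 'n::{finite,linorder}) coperator \<Rightarrow> bool"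
  where "unitary_op U \<longleftrightarrow>
    right_linear U \<and> U o\<^sub>L adj U = id_blinfun \<and> adj U o\<^sub>L U = id_blinfun"

definition imaginary_op :: "('h::real_inner, 'n::{finite,linorder}) coperator \<Rightarrow> bool"
  where "imaginary_op J \<longleftrightarrow> unitary_op J \<and> adj J = - J"

section \<open>Spectral measures and spectral integrals\<close>

definition imag_sphere :: "'n::{finite,linorder} clifford set"
  where "imag_sphere = {(\<Sum>j\<in>UNIV. t j *\<^sub>R gen j) | t. (\<Sum>j\<in>UNIV. (t j)\<^sup>2) = 1}"

definition cplane :: "'n::{finite,linorder} clifford \<Rightarrow> 'n clifford set"
  where "cplane \<II> = {s *\<^sub>R 1 + t *\<^sub>R \<II> | s t. True}"

text \<open>The imaginary part of an element of \<open>cplane \<II>\<close>; it depends on the choice of \<open>\<II>\<close>.\<close>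

definition cim :: "'n::{finite,linorder} clifford \<Rightarrow> 'n clifford \<Rightarrow> real"
  where "cim \<II> c = (THE t. \<exists>s. c = s *\<^sub>R 1 + t *\<^sub>R \<II>)"

definition spectral_measure ::
    "'w set \<Rightarrow> 'w set set \<Rightarrow> ('w set \<Rightarrow> ('h::real_inner, 'n::{finite,linorder}) coperator) \<Rightarrow> bool"
  where "spectral_measure \<Omega> \<A> E \<longleftrightarrow>
    sigma_algebra \<Omega> \<A> \<and>
    (\<forall>M\<in>\<A>. orth_projection (E M)) \<and>
    (\<forall>M :: nat \<Rightarrow> 'w set. range M \<subseteq> \<A> \<longrightarrow> disjoint_family M \<longrightarrow>
      (\<forall>x. (\<lambda>k. E (M k) x) sums E (\<Union>k. M k) x)) \<and>
    E \<Omega> = id_blinfun"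

definition associated ::
    "'w set set \<Rightarrow> ('w set \<Rightarrow> ('h::real_inner, 'n::{finite,linorder}) coperator) \<Rightarrow>
      ('h, 'n) coperator \<Rightarrow> bool"
  where "associated \<A> E J \<longleftrightarrow> (\<forall>M\<in>\<A>. J o\<^sub>L E M = E M o\<^sub>L J)"

definition bounded_measurable ::
    "'w set \<Rightarrow> 'w set set \<Rightarrow> 'n::{finite,linorder} clifford \<Rightarrow> ('w \<Rightarrow> 'n clifford) set"
  where "bounded_measurable \<Omega> \<A> \<II> =
    {f. f \<in> borel_measurable (sigma \<Omega> \<A>) \<and> f ` \<Omega> \<subseteq> cplane \<II> \<and> bounded (f ` \<Omega>)}"

text \<open>
  For simple \<open>f\<close> the representation with distinct values \<open>c\<close> and sets \<open>M\<^sub>c = f\<^sup>-\<^sup>1(c)\<close> is used.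
\<close>

definition simple_integral ::
    "'w set \<Rightarrow> ('w set \<Rightarrow> ('h::real_inner, 'n::{finite,linorder}) coperator) \<Rightarrow>
      ('h, 'n) coperator \<Rightarrow> 'n clifford \<Rightarrow> ('w \<Rightarrow> 'n clifford) \<Rightarrow> ('h, 'n) coperator"
  where "simple_integral \<Omega> E J \<II> f = (\<Sum>c\<in>f ` \<Omega>.
    cre c *\<^sub>R E (f -` {c} \<inter> \<Omega>) + cim \<II> c *\<^sub>R (E (f -` {c} \<inter> \<Omega>) o\<^sub>L J))"

definition spectral_integral ::
    "'w set \<Rightarrow> 'w set set \<Rightarrow> ('w set \<Rightarrow> ('h::real_inner, 'n::{finite,linorder}) coperator) \<Rightarrow>
      ('h, 'n) coperator \<Rightarrow> 'n clifford \<Rightarrow> ('w \<Rightarrow> 'n clifford) \<Rightarrow> ('h, 'n) coperator"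
  where "spectral_integral \<Omega> \<A> E J \<II> f = (THE T. \<exists>F :: nat \<Rightarrow> 'w \<Rightarrow> 'n clifford.
    (\<forall>k. simple_function (sigma \<Omega> \<A>) (F k) \<and> F k ` \<Omega> \<subseteq> cplane \<II>) \<and>
    uniform_limit \<Omega> F f sequentially \<and>
    (\<lambda>k. simple_integral \<Omega> E J \<II> (F k)) \<longlonglongrightarrow> T)"

text \<open>\<open>0\<close> is inserted so that the supremum over \<open>\<Omega> = {}\<close> is \<open>0\<close>.\<close>

definition sup_norm :: "'w set \<Rightarrow> ('w \<Rightarrow> 'b::real_normed_vector) \<Rightarrow> real"
  where "sup_norm \<Omega> f = Sup (insert 0 ((\<lambda>w. norm (f w)) ` \<Omega>))"

section \<open>Integrals against signed and Clifford-valued measures\<close>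

text \<open>
  The positive variation \<open>\<nu>\<^sup>+(A) = sup {\<nu>(B) | B \<subseteq> A}\<close> of a finite signed measure \<open>\<nu>\<close>; the negative
  variation is \<open>\<nu>\<^sup>- = (-\<nu>)\<^sup>+\<close>, and \<open>\<nu> = \<nu>\<^sup>+ - \<nu>\<^sup>-\<close> is the Jordan decomposition.
\<close>

definition pos_variation :: "'w set \<Rightarrow> 'w set set \<Rightarrow> ('w set \<Rightarrow> real) \<Rightarrow> 'w measure"
  where "pos_variation \<Omega> \<A> \<nu> = measure_of \<Omega> \<A> (\<lambda>A. SUP B\<in>{B \<in> \<A>. B \<subseteq> A}. ennreal (\<nu> B))"

definition signed_integral ::
    "'w set \<Rightarrow> 'w set set \<Rightarrow> ('w set \<Rightarrow> real) \<Rightarrow> ('w \<Rightarrow> real) \<Rightarrow> real"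
  where "signed_integral \<Omega> \<A> \<nu> h =
    integral\<^sup>L (pos_variation \<Omega> \<A> \<nu>) h - integral\<^sup>L (pos_variation \<Omega> \<A> (\<lambda>M. - \<nu> M)) h"

definition clifford_integral ::
    "'w set \<Rightarrow> 'w set set \<Rightarrow> ('w set \<Rightarrow> 'n clifford) \<Rightarrow> ('w \<Rightarrow> real) \<Rightarrow> 'n clifford"
  where "clifford_integral \<Omega> \<A> \<nu> h =
    Clifford (\<lambda>\<alpha>. signed_integral \<Omega> \<A> (\<lambda>M. coeff (\<nu> M) \<alpha>) h)"

end

theory Submission
  imports Defs
begin

text \<open>
  Sending \<open>s + t \<II>\<close> to the operator \<open>s + t J\<close> is a *-homomorphism multiplying norms by \<open>|s + t \<II>|\<close>
  (\<open>J\<close> is skew and \<open>J\<^sup>2 = -1\<close>), and it commutes with the pairwise orthogonal projections of a finite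
  partition. Hence on simple functions the integral is a *-homomorphism with norm at most the sup
  norm, and all of this passes to uniform limits. The adjoint, a priori a definite description, exists
  by the Riesz representation theorem. Every component of \<open>\<langle>E(M)x, y\<rangle>\<close> has the form of a real inner
  product \<open>E(M)x \<bullet> z\<close>, which by polarization is a difference of two finite measures; its Hahn
  decomposition identifies the variations, and (iv) extends from simple functions by uniform
  convergence. Applying it to \<open>cconj f * f\<close> gives (v), from which (vi) and, by dominated convergence,
  (vii) follow.
\<close>

section \<open>Riesz representation and adjoints\<close>

text \<open>Operator identities are proved for the real inner product, the scalar part of
  \<open>cinner\<close>. For a right linear operator this loses nothing: the other coefficients
  arise by replacing \<open>x\<close> with \<open>rmult x (basis_elem \<alpha>)\<close>, so a real
  adjoint is automatically the Clifford adjoint. Not only \<open>adj\<close> but also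
  \<open>cim\<close> and \<open>spectral_integral\<close> are definite descriptions, each evaluated
  by existence and uniqueness. For the integral, existence needs completeness of the operator space
  and uniqueness needs that any two approximating sequences have the same limit; both follow from
  one norm estimate on simple functions. Noncommutativity of the Clifford algebra does not
  interfere, because all integrands take values in a single plane, which multiplies like the complex
  numbers.\<close>

lemma riesz_representation:
  fixes \<phi> :: "'a::{real_inner,complete_space} \<Rightarrow> real"
  assumes "bounded_linear \<phi>"
  obtains z where "\<And>x. \<phi> x = x \<bullet> z"
proof -
  interpret bounded_linear \<phi> by fact
  \<comment> \<open>If \<open>z\<close> represents \<phi>, then \<open>q x\<close> is |x - z|^2 -
    |z|^2; hence \<open>z\<close> is sought as a minimizer of \<open>q\<close>.\<close>
  define q where "q x = x \<bullet> x - 2 * \<phi> x" for x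
  obtain K where K: "\<And>x. norm (\<phi> x) \<le> norm x * K"
    using bounded by blast
  have lower: "- K\<^sup>2 \<le> q x" for x
  proof -
    have "q x \<ge> (norm x)\<^sup>2 - 2 * (norm x * K)"
      using K[of x] by (simp add: q_def power2_norm_eq_inner)
    moreover have "0 \<le> (norm x - K)\<^sup>2"
      by simp
    ultimately show ?thesis
      by (simp add: power2_eq_square algebra_simps)
  qed
  define m where "m = Inf (range q)"
  have bdd: "bdd_below (range q)"
    by (rule bdd_belowI2) (rule lower)
  have m_le: "m \<le> q x" for x
    unfolding m_def using bdd by (intro cInf_lower) auto
  have "\<exists>x. q x < m + inverse (Suc n)" for n
    using cInf_lessD[of "range q" "m + inverse (Suc n)"] by (auto simp: m_def)
  then obtain X where X: "\<And>n. q (X n) < m + inverse (Suc n)"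
    by metis
  \<comment> \<open>The linear part of \<open>q\<close> cancels against the midpoint term. Since
    \<open>q\<close> is at least \<open>m\<close> at the midpoint, two points with values near
    \<open>m\<close> are near each other.\<close>
  have parallelogram: "(norm (a - b))\<^sup>2 / 2 = q a + q b - 2 * q ((1/2) *\<^sub>R (a + b))" for a b
    by (simp add: q_def power2_norm_eq_inner inner_commute add diff scaleR algebra_simps)
      (simp add: field_simps)
  have "Cauchy X"
  proof (rule metric_CauchyI)
    fix e :: real
    assume "0 < e"
    \<comment> \<open>Two values exceeding \<open>m\<close> by less than e^2 / 4 leave |X i - X j|^2
      / 2 < e^2 / 2.\<close>
    obtain N where N: "inverse (Suc N) < e\<^sup>2 / 4"
      using reals_Archimedean[of "e\<^sup>2 / 4"] \<open>0 < e\<close> by auto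
    have X_less: "q (X k) < m + e\<^sup>2 / 4" if "k \<ge> N" for k
    proof -
      have "inverse (real (Suc k)) \<le> inverse (real (Suc N))"
        using that by (simp add: field_simps)
      then show ?thesis
        using X[of k] N by linarith
    qed
    have "dist (X i) (X j) < e" if "i \<ge> N" "j \<ge> N" for i j
    proof -
      have "(norm (X i - X j))\<^sup>2 < e\<^sup>2"
        using parallelogram[of "X i" "X j"] m_le[of "(1/2) *\<^sub>R (X i + X j)"]
          X_less[OF that(1)] X_less[OF that(2)] by linarith
      then show ?thesis
        using \<open>0 < e\<close> by (simp add: dist_norm power2_less_imp_less)
    qed
    then show "\<exists>N. \<forall>i\<ge>N. \<forall>j\<ge>N. dist (X i) (X j) < e"
      by blast
  qed
  then obtain z where z: "X \<longlonglongrightarrow> z"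
    using Cauchy_convergent convergent_def by blast
  have "(\<lambda>n. q (X n)) \<longlonglongrightarrow> q z"
    unfolding q_def by (intro tendsto_intros tendsto z)
  moreover have "(\<lambda>n. m + inverse (real (Suc n))) \<longlonglongrightarrow> m + 0"
    by (intro tendsto_intros LIMSEQ_inverse_real_of_nat)
  ultimately have "q z \<le> m"
    using X by (intro LIMSEQ_le[of "\<lambda>n. q (X n)" _ "\<lambda>n. m + inverse (real (Suc n))"])
      (auto intro: less_imp_le)
  then have min: "q z \<le> q x" for x
    using m_le order_trans by blast
  have "\<phi> x = x \<bullet> z" for x
  proof (cases "x = 0")
    case False
    define d where "d = x \<bullet> z - \<phi> x"
    define s where "s = x \<bullet> x"
    have s: "s > 0"
      using False by (simp add: s_def)
    have "q (z + t *\<^sub>R x) = q z + 2 * t * d + t\<^sup>2 * s" for t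
      by (simp add: q_def d_def s_def add scaleR inner_commute power2_eq_square algebra_simps)
    \<comment> \<open>The quadratic in \<open>t\<close> is smallest at \<open>- d / s\<close>, where
      it lies d^2 / s below \<open>q z\<close>; minimality of \<open>q z\<close> then forces
      \<open>d\<close> to vanish.\<close>
    from this[of "- d / s"] have "0 \<le> 2 * (- d / s) * d + (- d / s)\<^sup>2 * s"
      using min[of "z + (- d / s) *\<^sub>R x"] by linarith
    also have "\<dots> = - (d\<^sup>2 / s)"
      using s by (simp add: power2_eq_square field_simps)
    finally have "d\<^sup>2 \<le> 0"
      using s by (simp add: divide_le_0_iff zero_le_divide_iff)
    then show ?thesis
      by (simp add: d_def)
  qed (simp add: zero)
  then show ?thesis
    using that by blast
qed

text \<open>Riesz represents the functional \<open>\<lambda>x. T x \<bullet> y\<close> for each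
  \<open>y\<close>. Testing it at \<open>s y\<close> and cancelling one factor
  \<open>norm (s y)\<close> bounds the representing map.\<close>

lemma ex_real_adjoint:
  fixes T :: "'a::{real_inner,complete_space} \<Rightarrow>\<^sub>L 'a"
  obtains S :: "'a \<Rightarrow>\<^sub>L 'a" where "\<And>x y. T x \<bullet> y = x \<bullet> S y"
proof -
  have "\<exists>z. \<forall>x. T x \<bullet> y = x \<bullet> z" for y
  proof -
    have "bounded_linear (\<lambda>x. T x \<bullet> y)"
      by (intro bounded_linear_inner_left_comp blinfun.bounded_linear_right)
    then show ?thesis
      by (metis riesz_representation)
  qed
  then obtain s where s: "\<And>x y. T x \<bullet> y = x \<bullet> s y"
    by metis
  have "s (x + y) = s x + s y" "s (r *\<^sub>R x) = r *\<^sub>R s x" for x y r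
    by (rule vector_eq_ldot[THEN iffD1], simp add: inner_simps flip: s)+
  moreover have "norm (s y) \<le> norm y * norm T" for y
  proof -
    have "(norm (s y))\<^sup>2 = T (s y) \<bullet> y"
      by (simp add: s power2_norm_eq_inner)
    also have "\<dots> \<le> norm T * norm (s y) * norm y"
      by (meson Cauchy_Schwarz_ineq2 abs_le_D1 mult_right_mono norm_blinfun norm_ge_zero order_trans)
    finally show ?thesis
      by (cases "norm (s y) = 0") (auto simp: power2_eq_square mult.commute mult.left_commute)
  qed
  ultimately have "bounded_linear s"
    by (intro bounded_linear_intro)
  then show ?thesis
    using that[of "Blinfun s"] s by (simp add: bounded_linear_Blinfun_apply)
qed

section \<open>Conjugation, the Clifford-valued inner product and the adjoint\<close>

lemma cconj_cconj [simp]: "cconj (cconj a) = a"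
  for a :: "'n::{finite,linorder} clifford"
  by (simp add: clifford_eq_iff coeff_cconj flip: mult.assoc)

lemma cconj_sum: "cconj (sum f A) = (\<Sum>i\<in>A. cconj (f i))"
  for f :: "'i \<Rightarrow> 'n::{finite,linorder} clifford"
  by (simp add: clifford_eq_iff coeff_cconj sum_distrib_left)

lemma cinner_commute: "cinner y x = cconj (cinner x y)"
  unfolding cinner_def
  by (subst sum.swap) (simp add: cconj_sum cconj_linear cconj_mult inner_commute)

lemma cinner_rmult_right: "cinner x (rmult y a) = cconj a * cinner x y"
  by (metis cinner_commute cinner_rmult cconj_mult)

text \<open>A product of basis elements is scalar only if their index sets agree, and the square of
  \<open>basis_elem \<alpha>\<close> is the sign
  \<open>reorder_sign \<alpha> \<alpha>\<close>.\<close>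

lemma cre_mult_basis_elem: "cre (a * basis_elem \<alpha>) = reorder_sign \<alpha> \<alpha> * coeff a \<alpha>"
  for a :: "'n::{finite,linorder} clifford"
  by (simp add: cre_def coeff_mult if_distrib[of "\<lambda>x. x * _"]
        if_distrib[of "\<lambda>x. _ * x"] cong: if_cong)

lemma coeff_eq_cre: "coeff a \<alpha> = reorder_sign \<alpha> \<alpha> * cre (a * basis_elem \<alpha>)"
  for a :: "'n::{finite,linorder} clifford"
  by (simp add: cre_mult_basis_elem flip: mult.assoc)

text \<open>Right multiplication by a basis element brings the chosen coefficient into the scalar
  part, and it can be absorbed into \<open>x\<close>. Thus the real inner product determines
  \<open>cinner\<close>.\<close>

lemma coeff_cinner: "coeff (cinner x y) \<alpha> = reorder_sign \<alpha> \<alpha> * (rmult x (basis_elem \<alpha>) \<bullet> y)"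
  by (simp only: coeff_eq_cre[of "cinner x y"] flip: cre_cinner cinner_rmult)

lemma cre_commute: "cre (a * b) = cre (b * a)"
  for a b :: "'n::{finite,linorder} clifford"
  by (simp add: cre_def coeff_mult mult.commute)

text \<open>The two sides are the scalar parts of \<open>cinner x y\<close> and \<open>a\<close>
  multiplied in opposite orders; \<open>cre\<close> is a trace.\<close>

lemma inner_rmult_left: "rmult x a \<bullet> y = x \<bullet> rmult y (cconj a)"
  by (simp add: cinner_rmult cinner_rmult_right cre_commute flip: cre_cinner)

lemma cinner_eq_iff: "(\<forall>x. cinner x y = cinner x z) \<longleftrightarrow> y = z"
  by (metis cre_cinner vector_eq_ldot)

text \<open>Since \<open>T\<close> commutes with \<open>rmult\<close>, the real adjoint relation at
  \<open>rmult x (basis_elem \<alpha>)\<close> gives every coefficient of the Clifford relation.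
  Nondegeneracy then yields right linearity of \<open>S\<close> and the uniqueness that evaluates
  the description \<open>adj\<close>.\<close>

lemma adj_eqI:
  fixes T S :: "('h::real_inner, 'n::{finite,linorder}) coperator"
  assumes T: "right_linear T" and S: "\<And>x y. T x \<bullet> y = x \<bullet> S y"
  shows "adj T = S" and "right_linear S"
proof -
  have c: "cinner (T x) y = cinner x (S y)" for x y
  proof (rule clifford_eqI)
    fix \<alpha>
    show "coeff (cinner (T x) y) \<alpha> = coeff (cinner x (S y)) \<alpha>"
      using T by (simp add: coeff_cinner right_linear_def S flip: S)
  qed
  have "cinner x (S (rmult y a)) = cinner x (rmult (S y) a)" for x y a
    by (simp add: cinner_rmult_right flip: c)
  then show R: "right_linear S"
    unfolding right_linear_def using cinner_eq_iff by blast
  show "adj T = S"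
    unfolding adj_def
  proof (rule the_equality)
    fix S'
    assume "right_linear S' \<and> (\<forall>x y. cinner (T x) y = cinner x (S' y))"
    then show "S' = S"
      by (metis blinfun_eqI c cinner_eq_iff)
  qed (use R c in blast)
qed

lemma inner_adj:
  fixes T :: "('h::{real_inner,complete_space}, 'n::{finite,linorder}) coperator"
  assumes "right_linear T"
  shows "T x \<bullet> y = x \<bullet> adj T y"
  by (metis adj_eqI(1) assms ex_real_adjoint)

section \<open>Complex planes in the Clifford algebra\<close>

lemma rmult_add: "rmult (x + y) a = rmult x a + rmult y a"
  by (simp add: rmult_def vec_eq_iff sum.distrib algebra_simps)

lemma rmult_scaleR: "rmult (r *\<^sub>R x) a = r *\<^sub>R rmult x a"
  by (simp add: rmult_def vec_eq_iff scaleR_sum_right mult.commute)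

text \<open>Conjugating and squaring a basis element produce the same sign, so the signs cancel.
  Norms in the algebra can thereby be computed by multiplication.\<close>

lemma inner_eq_cre: "a \<bullet> b = cre (cconj a * b)"
  for a b :: "'n::{finite,linorder} clifford"
proof -
  have "cre (cconj a * b) = (\<Sum>\<alpha>\<in>UNIV. coeff a \<alpha> * coeff b \<alpha> * (reorder_sign \<alpha> \<alpha> * reorder_sign \<alpha> \<alpha>))"
    unfolding cre_def coeff_mult coeff_cconj by (intro sum.cong refl) simp
  then show ?thesis
    by (simp add: inner_clifford_def)
qed

lemma cre_simps [simp]:
  "cre (a + b) = cre a + cre b" "cre (a - b) = cre a - cre b"
  "cre (r *\<^sub>R a) = r * cre a" "cre (- a) = - cre a" "cre 0 = 0"
  by (simp_all add: cre_def)

lemma cre_one [simp]: "cre (1 :: 'n::{finite,linorder} clifford) = 1"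
  by (simp add: cre_def one_clifford_def)

lemma bounded_linear_cre: "bounded_linear (cre :: 'n::{finite,linorder} clifford \<Rightarrow> real)"
proof -
  have "cre = (\<bullet>) (1 :: 'n clifford)"
    by (simp add: fun_eq_iff inner_eq_cre cconj_one)
  then show ?thesis
    using bounded_linear_inner_right[of "1 :: 'n clifford"] by simp
qed

lemma bounded_bilinear_clifford_mult:
  "bounded_bilinear ((*) :: 'n::{finite,linorder} clifford \<Rightarrow> _)"
  by (subst bilinear_conv_bounded_bilinear[symmetric])
    (simp add: bilinear_def linear_iff algebra_simps)

context
  fixes \<II> :: "'n::{finite,linorder} clifford"
  assumes \<II>: "\<II> \<in> imag_sphere"
begin

text \<open>Adding the square to itself with the two indices exchanged leaves only anticommutators
  of generators, which vanish off the diagonal and equal -2 on it.\<close>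

lemma imag_square: "\<II> * \<II> = -1"
  and cconj_imag: "cconj \<II> = - \<II>"
proof -
  obtain t where t: "\<II> = (\<Sum>j\<in>UNIV. t j *\<^sub>R gen j)" "(\<Sum>j\<in>UNIV. (t j)\<^sup>2) = (1::real)"
    using \<II> by (auto simp: imag_sphere_def)
  have sq: "\<II> * \<II> = (\<Sum>i\<in>UNIV. \<Sum>j\<in>UNIV. (t i * t j) *\<^sub>R (gen i * gen j))"
    by (simp add: t sum_product mult.commute)
  also have "\<dots> = (\<Sum>i\<in>UNIV. \<Sum>j\<in>UNIV. (t i * t j) *\<^sub>R (gen j * gen i))"
    by (subst sum.swap, intro sum.cong refl) (simp add: mult.commute)
  finally have "\<II> * \<II> + \<II> * \<II> = (\<Sum>i\<in>UNIV. \<Sum>j\<in>UNIV. (t i * t j) *\<^sub>R (gen i * gen j + gen j * gen i))"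
    by (subst (2) sq) (simp add: sum.distrib algebra_simps)
  also have "\<dots> = (\<Sum>i\<in>UNIV. \<Sum>j\<in>UNIV. if j = i then (t i * t i) *\<^sub>R (- 2) else 0)"
  proof (intro sum.cong refl)
    fix i j :: 'n
    show "(t i * t j) *\<^sub>R (gen i * gen j + gen j * gen i)
        = (if j = i then (t i * t i) *\<^sub>R (- 2) else 0 :: 'n clifford)"
      by (cases "i = j") (simp_all add: gen_anticommute[of i j] gen_square)
  qed
  also have "\<dots> = (\<Sum>i\<in>UNIV. (t i)\<^sup>2) *\<^sub>R (- 2)"
    by (simp only: sum.delta sum.delta' UNIV_I if_True finite power2_eq_square scaleR_sum_left)
  finally have "2 *\<^sub>R (\<II> * \<II>) = 2 *\<^sub>R (- 1)"
    by (simp add: t(2) scaleR_2)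
  then show "\<II> * \<II> = -1"
    by (metis scaleR_cancel_left zero_neq_numeral)
  show "cconj \<II> = - \<II>"
    by (simp add: t(1) cconj_sum cconj_linear cconj_gen sum_negf)
qed

text \<open>As \<open>cconj \<II> = - \<II>\<close>, symmetry of the inner product of 1 and \<II>
  says that this scalar part equals its own negative.\<close>

lemma cre_imag: "cre \<II> = 0"
  using inner_commute[of 1 \<II>] by (simp add: inner_eq_cre cconj_imag cconj_one)

lemma norm_imag: "\<II> \<bullet> \<II> = 1"
  by (simp add: inner_eq_cre cconj_imag imag_square)

lemma one_inner_imag: "1 \<bullet> \<II> = 0" "\<II> \<bullet> 1 = 0"
  by (simp_all add: inner_eq_cre cconj_one cre_imag cconj_imag)

text \<open>\<II> is a unit vector orthogonal to 1, so pairing with it reads off the coefficient and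
  makes the description unique.\<close>

lemma cim_cplane [simp]: "cim \<II> (s *\<^sub>R 1 + t *\<^sub>R \<II>) = t"
  unfolding cim_def
proof (rule the_equality)
  fix t'
  assume "\<exists>s'. s *\<^sub>R 1 + t *\<^sub>R \<II> = s' *\<^sub>R 1 + t' *\<^sub>R \<II>"
  then obtain s' where "s *\<^sub>R 1 + t *\<^sub>R \<II> = s' *\<^sub>R 1 + t' *\<^sub>R \<II>"
    by blast
  then have "(s *\<^sub>R 1 + t *\<^sub>R \<II>) \<bullet> \<II> = (s' *\<^sub>R 1 + t' *\<^sub>R \<II>) \<bullet> \<II>"
    by simp
  then show "t' = t"
    by (simp add: inner_simps norm_imag one_inner_imag)
qed blast

lemma cre_cplane: "cre (s *\<^sub>R 1 + t *\<^sub>R \<II>) = s"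
  by (simp add: cre_imag)

lemma cplaneI: "s *\<^sub>R 1 + t *\<^sub>R \<II> \<in> cplane \<II>"
  by (auto simp: cplane_def)

lemma cplane_expansion: "c \<in> cplane \<II> \<Longrightarrow> c = cre c *\<^sub>R 1 + cim \<II> c *\<^sub>R \<II>"
  by (auto simp: cplane_def cre_imag)

text \<open>Off the plane \<open>cim\<close> has no meaning, whereas pairing with \<II> is a bounded
  linear functional on the whole algebra. Measurability and limits of imaginary parts go through
  this functional.\<close>

lemma cim_eq_inner: "c \<in> cplane \<II> \<Longrightarrow> cim \<II> c = c \<bullet> \<II>"
  by (auto simp: cplane_def inner_simps norm_imag one_inner_imag)

lemma cplane_eqI:
  assumes "c = s *\<^sub>R 1 + t *\<^sub>R \<II>"
  shows "c \<in> cplane \<II> \<and> cre c = s \<and> cim \<II> c = t"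
  unfolding assms by (simp only: cplaneI cre_cplane cim_cplane simp_thms)

lemma cplane_add:
  assumes "c \<in> cplane \<II>" "d \<in> cplane \<II>"
  shows "c + d \<in> cplane \<II> \<and> cre (c + d) = cre c + cre d \<and> cim \<II> (c + d) = cim \<II> c + cim \<II> d"
  by (rule cplane_eqI, subst cplane_expansion[OF assms(1)], subst cplane_expansion[OF assms(2)])
    (simp add: algebra_simps)

lemma cplane_diff:
  assumes "c \<in> cplane \<II>" "d \<in> cplane \<II>"
  shows "c - d \<in> cplane \<II> \<and> cre (c - d) = cre c - cre d \<and> cim \<II> (c - d) = cim \<II> c - cim \<II> d"
  by (rule cplane_eqI, subst cplane_expansion[OF assms(1)], subst cplane_expansion[OF assms(2)])
    (simp add: algebra_simps)

lemma cplane_mult: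
  assumes "c \<in> cplane \<II>" "d \<in> cplane \<II>"
  shows "c * d \<in> cplane \<II> \<and> cre (c * d) = cre c * cre d - cim \<II> c * cim \<II> d \<and>
    cim \<II> (c * d) = cre c * cim \<II> d + cim \<II> c * cre d"
  by (rule cplane_eqI, subst cplane_expansion[OF assms(1)], subst cplane_expansion[OF assms(2)])
    (simp add: algebra_simps imag_square)

lemma cplane_cconj:
  assumes "c \<in> cplane \<II>"
  shows "cconj c \<in> cplane \<II> \<and> cre (cconj c) = cre c \<and> cim \<II> (cconj c) = - cim \<II> c"
  by (rule cplane_eqI, subst cplane_expansion[OF assms(1)])
    (simp add: cconj_linear cconj_one cconj_imag)

lemma cplane_scaleR_one: "r *\<^sub>R 1 \<in> cplane \<II> \<and> cre (r *\<^sub>R 1) = r \<and> cim \<II> (r *\<^sub>R 1) = 0"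
  using cplane_eqI[of "r *\<^sub>R 1" r 0] by simp

lemma cplane_imag: "\<II> \<in> cplane \<II> \<and> cre \<II> = 0 \<and> cim \<II> \<II> = 1"
  using cplane_eqI[of \<II> 0 1] by simp

lemma norm_cplane:
  assumes "c \<in> cplane \<II>"
  shows "(norm c)\<^sup>2 = (cre c)\<^sup>2 + (cim \<II> c)\<^sup>2"
proof -
  have "(norm c)\<^sup>2 = cre (cconj c * c)"
    by (simp only: inner_eq_cre power2_norm_eq_inner)
  then show ?thesis
    using cplane_cconj[OF assms] cplane_mult[of "cconj c" c] assms by (simp add: power2_eq_square)
qed

lemma cconj_mult_self:
  assumes "c \<in> cplane \<II>"
  shows "cconj c * c = (norm c)\<^sup>2 *\<^sub>R 1"
proof -
  have "cconj c * c = cre (cconj c * c) *\<^sub>R 1 + cim \<II> (cconj c * c) *\<^sub>R \<II>"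
    using cplane_cconj[OF assms] cplane_mult[of "cconj c" c] assms by (intro cplane_expansion) blast
  moreover have "cim \<II> (cconj c * c) = 0"
    using cplane_cconj[OF assms] cplane_mult[of "cconj c" c] assms by (simp add: mult.commute)
  ultimately show ?thesis
    by (simp add: power2_norm_eq_inner inner_eq_cre)
qed

end

section \<open>Spectral measures and the operators replacing scalars of the plane\<close>

locale spectral_calculus =
  fixes \<Omega> :: "'w set" and \<A> :: "'w set set"
    and E :: "'w set \<Rightarrow> ('h::{real_inner,complete_space}, 'n::{finite,linorder}) coperator"
    and J :: "('h, 'n) coperator"
    and \<II> :: "'n clifford"
  assumes spectral: "spectral_measure \<Omega> \<A> E"
    and imaginary: "imaginary_op J"
    and associated: "associated \<A> E J"
    and \<II>: "\<II> \<in> imag_sphere"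
begin

sublocale sigma_algebra \<Omega> \<A>
  using spectral by (simp add: spectral_measure_def)

lemma E_sums:
  assumes "range M \<subseteq> \<A>" "disjoint_family M"
  shows "(\<lambda>k. E (M k) x) sums E (\<Union>k. M k) x"
  using spectral assms by (simp add: spectral_measure_def)

lemma E_space: "E \<Omega> x = x"
  using spectral by (simp add: spectral_measure_def)

lemma right_linear_E: "M \<in> \<A> \<Longrightarrow> right_linear (E M)"
  using spectral by (simp add: spectral_measure_def orth_projection_def)

lemma E_selfadjoint: "M \<in> \<A> \<Longrightarrow> E M x \<bullet> y = x \<bullet> E M y"
  using spectral inner_adj[of "E M"] by (simp add: spectral_measure_def orth_projection_def)

lemma E_idem: "M \<in> \<A> \<Longrightarrow> E M (E M x) = E M x"
  using spectral by (metis blinfun_apply_blinfun_compose orth_projection_def spectral_measure_def)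

lemma E_norm: "M \<in> \<A> \<Longrightarrow> E M x \<bullet> x = (norm (E M x))\<^sup>2"
  by (metis E_idem E_selfadjoint power2_norm_eq_inner)

lemma right_linear_J: "right_linear J"
  using imaginary by (simp add: imaginary_op_def unitary_op_def)

lemma J_skew: "J x \<bullet> y = - (x \<bullet> J y)"
  using inner_adj[OF right_linear_J, of x y] imaginary
  by (simp add: imaginary_op_def blinfun.bilinear_simps inner_simps)

lemma J_J: "J (J x) = - x"
proof -
  have "J o\<^sub>L adj J = id_blinfun"
    using imaginary unfolding imaginary_op_def unitary_op_def by blast
  moreover have "adj J = - J"
    using imaginary by (simp add: imaginary_op_def)
  ultimately have "(J o\<^sub>L - J) x = id_blinfun x"
    by simp
  then have "- J (J x) = x"
    by (simp add: blinfun.minus_left blinfun.minus_right)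
  then show ?thesis
    by (metis add.inverse_inverse)
qed

lemma E_J:
  assumes "M \<in> \<A>"
  shows "J (E M x) = E M (J x)"
proof -
  have "J o\<^sub>L E M = E M o\<^sub>L J"
    using associated assms unfolding associated_def by blast
  then show ?thesis
    by (simp flip: blinfun_apply_blinfun_compose)
qed

text \<open>The constant family of empty sets is disjoint, so the series with constant term
  \<open>E {} x\<close> converges, which forces the term to be 0.\<close>

lemma E_empty: "E {} x = 0"
proof -
  have "(\<lambda>k. E {} x) sums E {} x"
    using E_sums[of "\<lambda>_. {}"] by (simp add: disjoint_family_on_def)
  then have "(\<lambda>k. E {} x) \<longlonglongrightarrow> 0"
    by (intro summable_LIMSEQ_zero) (auto simp: sums_iff)
  then show ?thesis
    by (simp add: LIMSEQ_const_iff)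
qed

lemma E_Un:
  assumes "A \<in> \<A>" "B \<in> \<A>" "A \<inter> B = {}"
  shows "E (A \<union> B) x = E A x + E B x"
proof -
  have "(\<lambda>k. E (binaryset A B k) x) sums E (\<Union>k. binaryset A B k) x"
    using assms by (intro E_sums) (auto simp: range_binaryset_eq disjoint_family_on_def binaryset_def)
  moreover have "(\<lambda>k. E (binaryset A B k) x) sums (\<Sum>k<2. E (binaryset A B k) x)"
    by (rule sums_finite) (auto simp: binaryset_def E_empty)
  ultimately have "E (\<Union>k. binaryset A B k) x = (\<Sum>k<2. E (binaryset A B k) x)"
    by (rule sums_unique2)
  then show ?thesis
    by (simp add: UN_binaryset_eq binaryset_def numeral_2_eq_2)
qed

lemma E_UNION:
  assumes "finite I" "\<And>i. i \<in> I \<Longrightarrow> M i \<in> \<A>" "disjoint_family_on M I"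
  shows "E (\<Union>i\<in>I. M i) x = (\<Sum>i\<in>I. E (M i) x)"
  using assms
proof (induction I rule: finite_induct)
  case (insert i I)
  have disj: "M i \<inter> (\<Union>i\<in>I. M i) = {}" "disjoint_family_on M I"
    using insert.hyps insert.prems by (auto simp: disjoint_family_on_def)
  have "(\<Union>i\<in>I. M i) \<in> \<A>"
    using insert.hyps insert.prems by (intro finite_UN) auto
  then have "E (M i \<union> (\<Union>i\<in>I. M i)) x = E (M i) x + E (\<Union>i\<in>I. M i) x"
    using insert.prems(1) disj(1) by (intro E_Un) auto
  also have "E (\<Union>i\<in>I. M i) x = (\<Sum>i\<in>I. E (M i) x)"
    using insert.prems(1) disj(2) by (intro insert.IH) auto
  finally show ?case
    using insert.hyps by simp
qed (simp add: E_empty)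

text \<open>Two projections whose sum is a projection have orthogonal ranges.\<close>

lemma E_disjoint:
  assumes "A \<in> \<A>" "B \<in> \<A>" "A \<inter> B = {}"
  shows "E A (E B x) = 0"
proof -
  have cross: "E A (E B x) = - E B (E A x)" for x
  proof -
    have "E (A \<union> B) (E (A \<union> B) x) = E (A \<union> B) x"
      using assms by (intro E_idem) auto
    then show ?thesis
      using assms by (simp add: E_Un E_idem blinfun.add_right eq_neg_iff_add_eq_0 add.commute)
  qed
  \<comment> \<open>Write A, B for the two projections. Anticommuting twice turns AAB into BAA, so
    idempotence gives AB = BA, while \<open>cross\<close> says AB = -BA.\<close>
  have "E A (E B x) = E A (E A (E B x))"
    using assms by (simp add: E_idem)
  also have "\<dots> = E B (E A (E A x))"
    using cross[of "E A x"] cross[of x] by (simp add: blinfun.bilinear_simps)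
  also have "\<dots> = - E A (E B x)"
    using assms cross[of x] by (simp add: E_idem)
  finally have "E A (E B x) + E A (E B x) = 0"
    by (metis add.left_inverse)
  then have "2 *\<^sub>R E A (E B x) = 0"
    by (simp only: scaleR_2)
  then show ?thesis
    by simp
qed

definition scalar_op :: "'n clifford \<Rightarrow> ('h, 'n) coperator"
  where "scalar_op c = cre c *\<^sub>R id_blinfun + cim \<II> c *\<^sub>R J"

lemma scalar_op_apply: "scalar_op c x = cre c *\<^sub>R x + cim \<II> c *\<^sub>R J x"
  by (simp add: scalar_op_def blinfun.bilinear_simps)

lemma scalar_op_add:
  assumes "c \<in> cplane \<II>" "d \<in> cplane \<II>"
  shows "scalar_op (c + d) x = scalar_op c x + scalar_op d x"
  using cplane_add[OF \<II> assms] by (simp add: scalar_op_apply algebra_simps)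

lemma scalar_op_diff:
  assumes "c \<in> cplane \<II>" "d \<in> cplane \<II>"
  shows "scalar_op (c - d) x = scalar_op c x - scalar_op d x"
  using cplane_diff[OF \<II> assms] by (simp add: scalar_op_apply scaleR_diff_left)

lemma scalar_op_mult:
  assumes "c \<in> cplane \<II>" "d \<in> cplane \<II>"
  shows "scalar_op (c * d) x = scalar_op c (scalar_op d x)"
  using cplane_mult[OF \<II> assms]
  by (simp add: scalar_op_apply blinfun.add_right blinfun.scaleR_right J_J scaleR_diff_left
      scaleR_add_left scaleR_add_right scaleR_diff_right mult.commute)

lemma scalar_op_cconj:
  assumes "c \<in> cplane \<II>"
  shows "scalar_op c x \<bullet> y = x \<bullet> scalar_op (cconj c) y"
  using cplane_cconj[OF \<II> assms] by (simp add: scalar_op_apply inner_simps J_skew)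

lemma scalar_op_norm:
  assumes "c \<in> cplane \<II>"
  shows "norm (scalar_op c x) = norm c * norm x"
proof -
  have "J x \<bullet> x = 0" "J x \<bullet> J x = x \<bullet> x"
    using J_skew[of x x] J_skew[of x "J x"] by (simp_all add: J_J inner_commute)
  then have "(norm (scalar_op c x))\<^sup>2 = ((cre c)\<^sup>2 + (cim \<II> c)\<^sup>2) * (norm x)\<^sup>2"
    by (simp only: power2_norm_eq_inner scalar_op_apply inner_simps inner_commute[of x "J x"])
      (simp add: power2_eq_square algebra_simps)
  then have "(norm (scalar_op c x))\<^sup>2 = (norm c * norm x)\<^sup>2"
    by (simp add: norm_cplane[OF \<II> assms] power_mult_distrib)
  then show ?thesis
    by simp
qed

lemma scalar_op_E: "M \<in> \<A> \<Longrightarrow> scalar_op c (E M x) = E M (scalar_op c x)"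
  by (simp add: scalar_op_apply blinfun.bilinear_simps E_J)

lemma right_linear_comb:
  fixes S T :: "('h, 'n) coperator"
  assumes "right_linear S" "right_linear T"
  shows "right_linear (r *\<^sub>R S)" "right_linear (S + T)" "right_linear (S o\<^sub>L T)"
  using assms by (auto simp: right_linear_def blinfun.bilinear_simps rmult_add rmult_scaleR)

end

section \<open>The spectral integral of simple functions and its uniform limits\<close>

text \<open>The pointwise limit exists by completeness of the codomain and inherits a bound from the
  Cauchy sequence. The Cauchy estimate is uniform on the unit ball and survives the limit in
  \<open>m\<close>, giving convergence in operator norm.\<close>

lemma blinfun_Cauchy_convergent:
  fixes X :: "nat \<Rightarrow> 'a::real_normed_vector \<Rightarrow>\<^sub>L 'b::{real_normed_vector,complete_space}"
  assumes "Cauchy X"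
  shows "convergent X"
proof -
  have "Cauchy (\<lambda>n. X n x)" for x
    using bounded_linear.Cauchy[OF blinfun.bounded_linear_left assms] .
  then have "\<exists>y. (\<lambda>n. X n x) \<longlonglongrightarrow> y" for x
    by (simp add: Cauchy_convergent_iff convergent_def)
  then obtain T where T: "\<And>x. (\<lambda>n. X n x) \<longlonglongrightarrow> T x"
    by metis
  obtain K where K: "\<And>n. norm (X n) \<le> K"
    using Cauchy_Bseq[OF assms] by (auto simp: Bseq_def)
  have "bounded_linear T"
  proof (rule bounded_linear_intro)
    fix x y r
    show "T (x + y) = T x + T y"
      using T[of "x + y"] tendsto_add[OF T[of x] T[of y]]
      by (auto simp: blinfun.add_right intro: LIMSEQ_unique)
    show "T (r *\<^sub>R x) = r *\<^sub>R T x"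
      using T[of "r *\<^sub>R x"] tendsto_scaleR[OF tendsto_const[of r] T[of x]]
      by (auto simp: blinfun.scaleR_right intro: LIMSEQ_unique)
    have "norm (X n x) \<le> norm x * K" for n
      using norm_blinfun[of "X n" x] mult_right_mono[OF K[of n] norm_ge_zero[of x]]
      by (simp add: mult.commute)
    then show "norm (T x) \<le> norm x * K"
      using tendsto_norm[OF T[of x]] by (intro LIMSEQ_le_const2) auto
  qed
  then have Blinfun: "Blinfun T x = T x" for x
    by (simp add: bounded_linear_Blinfun_apply)
  have "X \<longlonglongrightarrow> Blinfun T"
  proof (rule LIMSEQ_I)
    fix e :: real
    assume "0 < e"
    then obtain N where N: "\<And>m n. m \<ge> N \<Longrightarrow> n \<ge> N \<Longrightarrow> norm (X m - X n) < e / 2"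
      using CauchyD[OF assms, of "e / 2"] by auto
    have "norm (X n - Blinfun T) \<le> e / 2" if "n \<ge> N" for n
    proof (rule norm_blinfun_bound)
      fix x
      have "norm (X n x - X m x) \<le> e / 2 * norm x" if "m \<ge> N" for m
        using norm_blinfun[of "X n - X m" x] mult_right_mono[of "norm (X n - X m)" "e / 2" "norm x"]
          N[OF \<open>n \<ge> N\<close> that] by (simp add: blinfun.diff_left)
      moreover have "(\<lambda>m. norm (X n x - X m x)) \<longlonglongrightarrow> norm (X n x - T x)"
        by (intro tendsto_intros T)
      ultimately show "norm ((X n - Blinfun T) x) \<le> e / 2 * norm x"
        unfolding blinfun.diff_left Blinfun by (intro LIMSEQ_le_const2) auto
    qed (use \<open>0 < e\<close> in simp)
    then show "\<exists>N. \<forall>n\<ge>N. norm (X n - Blinfun T) < e"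
      using \<open>0 < e\<close> by (intro exI[of _ N]) force
  qed
  then show ?thesis
    by (auto simp: convergent_def)
qed

text \<open>A subspace of a finite-dimensional space is closed; limits of plane-valued functions
  therefore remain plane-valued.\<close>

lemma closed_cplane:
  assumes "\<II> \<in> imag_sphere"
  shows "closed (cplane \<II>)"
proof -
  have "r *\<^sub>R c \<in> cplane \<II>" if "c \<in> cplane \<II>" for c r
  proof -
    have "r *\<^sub>R c = (r *\<^sub>R 1) * c"
      by simp
    then show ?thesis
      using cplane_mult[OF assms, of "r *\<^sub>R 1" c] cplane_scaleR_one[OF assms] that by metis
  qed
  moreover have "0 \<in> cplane \<II>"
    using cplane_scaleR_one[OF assms, of 0] by simp
  ultimately have "subspace (cplane \<II>)"
    using cplane_add[OF assms] by (auto simp: subspace_def)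
  then show ?thesis
    by (rule closed_subspace)
qed

context spectral_calculus
begin

abbreviation simple :: "('w \<Rightarrow> 'a) \<Rightarrow> bool"
  where "simple \<equiv> simple_function (sigma \<Omega> \<A>)"

abbreviation SI :: "('w \<Rightarrow> 'n clifford) \<Rightarrow> ('h, 'n) coperator"
  where "SI \<equiv> simple_integral \<Omega> E J \<II>"

abbreviation spectral_int :: "('w \<Rightarrow> 'n clifford) \<Rightarrow> ('h, 'n) coperator"
  where "spectral_int \<equiv> spectral_integral \<Omega> \<A> E J \<II>"

lemma sigma_simps [simp]: "sets (sigma \<Omega> \<A>) = \<A>" "space (sigma \<Omega> \<A>) = \<Omega>"
  by (rule sets_measure_of_eq, rule space_measure_of_eq)

lemma simpleD:
  assumes "simple h"
  shows "finite (h ` \<Omega>)" "h -` {c} \<inter> \<Omega> \<in> \<A>"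
  using simple_functionD(2)[OF assms, of "{c}"] simple_functionD(1)[OF assms] by simp_all

lemma SI_eq:
  assumes "simple f"
  shows "SI f = (\<Sum>c\<in>f ` \<Omega>. scalar_op c o\<^sub>L E (f -` {c} \<inter> \<Omega>))"
  unfolding simple_integral_def
  by (intro sum.cong refl blinfun_eqI)
    (simp add: scalar_op_apply blinfun.bilinear_simps E_J simpleD[OF assms])

text \<open>Independence of the representation: each fibre of \<open>u\<close> after
  \<open>h\<close> is a finite disjoint union of fibres of \<open>h\<close>, and \<open>E\<close> is
  additive on it. Because \<open>u\<close> need not be injective and \<open>h\<close> may have any
  value type, several simple functions can share one partition.\<close>

lemma SI_compose:
  assumes h: "simple h"
  shows "SI (\<lambda>w. u (h w)) x = (\<Sum>d\<in>h ` \<Omega>. scalar_op (u d) (E (h -` {d} \<inter> \<Omega>) x))"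
proof -
  define S where "S = h ` \<Omega>"
  define H where "H d = h -` {d} \<inter> \<Omega>" for d
  have S: "finite S" and H: "\<And>d. H d \<in> \<A>"
    using simpleD[OF h] by (auto simp: S_def H_def)
  have "simple (\<lambda>w. u (h w))"
    using simple_function_compose[OF h, of u] by (simp add: o_def)
  then have "SI (\<lambda>w. u (h w)) x
      = (\<Sum>c\<in>u ` S. scalar_op c (E ((\<lambda>w. u (h w)) -` {c} \<inter> \<Omega>) x))"
    by (simp add: SI_eq blinfun.sum_left S_def image_image)
  also have "\<dots> = (\<Sum>c\<in>u ` S. \<Sum>d\<in>{d \<in> S. u d = c}. scalar_op (u d) (E (H d) x))"
  proof (rule sum.cong[OF refl])
    fix c
    have "(\<lambda>w. u (h w)) -` {c} \<inter> \<Omega> = (\<Union>d\<in>{d \<in> S. u d = c}. H d)"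
      by (auto simp: S_def H_def)
    moreover have "E (\<Union>d\<in>{d \<in> S. u d = c}. H d) x = (\<Sum>d\<in>{d \<in> S. u d = c}. E (H d) x)"
      using S H by (intro E_UNION) (auto simp: disjoint_family_on_def H_def)
    ultimately show "scalar_op c (E ((\<lambda>w. u (h w)) -` {c} \<inter> \<Omega>) x)
        = (\<Sum>d\<in>{d \<in> S. u d = c}. scalar_op (u d) (E (H d) x))"
      by (simp add: blinfun.sum_right)
  qed
  also have "\<dots> = (\<Sum>d\<in>S. scalar_op (u d) (E (H d) x))"
    by (rule sum.image_gen[OF S, symmetric])
  finally show ?thesis
    by (simp add: S_def H_def)
qed

lemma SI_apply:
  assumes "simple f"
  shows "SI f x = (\<Sum>c\<in>f ` \<Omega>. scalar_op c (E (f -` {c} \<inter> \<Omega>) x))"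
  using SI_compose[OF assms, of "\<lambda>c. c"] by simp

text \<open>The summands lie in the orthogonal ranges of the fibre projections, so Pythagoras
  reduces the claim to single terms, each scaled by at most \<open>B\<close>. The fibres cover
  \<Omega>, so the projected parts of \<open>x\<close> reassemble to \<open>x\<close>.\<close>

lemma SI_norm_le:
  assumes "simple f" "f ` \<Omega> \<subseteq> cplane \<II>" "0 \<le> B" "\<And>w. w \<in> \<Omega> \<Longrightarrow> norm (f w) \<le> B"
  shows "norm (SI f x) \<le> B * norm x"
proof -
  define P where "P c = E (f -` {c} \<inter> \<Omega>)" for c
  note sets = simpleD[OF assms(1)]
  have fin: "finite (f ` \<Omega>)"
    by (rule sets)
  have ortho: "P c (P d y) = 0" if "c \<noteq> d" for c d y
    unfolding P_def using that by (intro E_disjoint sets) auto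
  have comm: "scalar_op c (P d y) = P d (scalar_op c y)" for c d y
    unfolding P_def by (intro scalar_op_E sets)
  have selfadj: "P c y \<bullet> z = y \<bullet> P c z" for c y z
    unfolding P_def by (intro E_selfadjoint sets)
  have "(norm (SI f x))\<^sup>2 = (\<Sum>c\<in>f ` \<Omega>. (norm (scalar_op c (P c x)))\<^sup>2)"
    unfolding SI_apply[OF assms(1)] P_def[symmetric]
    by (intro norm_sum_Pythagorean fin) (auto simp: pairwise_def orthogonal_def comm selfadj ortho)
  also have "\<dots> \<le> (\<Sum>c\<in>f ` \<Omega>. B\<^sup>2 * (norm (P c x))\<^sup>2)"
  proof (rule sum_mono)
    fix c
    assume c: "c \<in> f ` \<Omega>"
    then have "norm (scalar_op c (P c x)) \<le> B * norm (P c x)"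
      using assms by (subst scalar_op_norm) (auto intro: mult_right_mono)
    then show "(norm (scalar_op c (P c x)))\<^sup>2 \<le> B\<^sup>2 * (norm (P c x))\<^sup>2"
      by (metis norm_ge_zero power_mono power_mult_distrib)
  qed
  also have "\<dots> = B\<^sup>2 * (norm (\<Sum>c\<in>f ` \<Omega>. P c x))\<^sup>2"
    unfolding sum_distrib_left[symmetric]
    by (subst norm_sum_Pythagorean[OF fin])
      (auto simp: pairwise_def orthogonal_def selfadj ortho)
  also have "(\<Sum>c\<in>f ` \<Omega>. P c x) = E (\<Union>c\<in>f ` \<Omega>. f -` {c} \<inter> \<Omega>) x"
    unfolding P_def by (rule E_UNION[symmetric]) (auto simp: fin sets disjoint_family_on_def)
  also have "(\<Union>c\<in>f ` \<Omega>. f -` {c} \<inter> \<Omega>) = \<Omega>"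
    by auto
  finally have "(norm (SI f x))\<^sup>2 \<le> (B * norm x)\<^sup>2"
    by (simp add: E_space power_mult_distrib)
  then show ?thesis
    using assms(3) by (simp add: power2_le_iff_abs_le)
qed

lemma
  assumes f: "simple f" "f ` \<Omega> \<subseteq> cplane \<II>" and g: "simple g" "g ` \<Omega> \<subseteq> cplane \<II>"
  shows SI_add: "SI (\<lambda>w. f w + g w) = SI f + SI g"
    and SI_diff: "SI (\<lambda>w. f w - g w) = SI f - SI g"
    and SI_mult: "SI (\<lambda>w. f w * g w) = SI f o\<^sub>L SI g"
proof -
  \<comment> \<open>The fibres of the pair form the common refinement of the partitions of
    \<open>f\<close> and \<open>g\<close>.\<close>
  define h where "h w = (f w, g w)" for w
  have h: "simple h"
    unfolding h_def using f g by (intro simple_function_Pair)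
  have mem: "fst d \<in> cplane \<II>" "snd d \<in> cplane \<II>" if "d \<in> h ` \<Omega>" for d
    using that f g by (auto simp: h_def)
  define P where "P d = E (h -` {d} \<inter> \<Omega>)" for d
  note sets = simpleD[OF h]
  have f_eq: "SI f x = (\<Sum>d\<in>h ` \<Omega>. scalar_op (fst d) (P d x))" for x
    using SI_compose[OF h, of fst x] by (simp add: h_def P_def)
  have g_eq: "SI g x = (\<Sum>d\<in>h ` \<Omega>. scalar_op (snd d) (P d x))" for x
    using SI_compose[OF h, of snd x] by (simp add: h_def P_def)
  show "SI (\<lambda>w. f w + g w) = SI f + SI g"
  proof (rule blinfun_eqI)
    fix x
    have "SI (\<lambda>w. f w + g w) x = (\<Sum>d\<in>h ` \<Omega>. scalar_op (fst d + snd d) (P d x))"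
      using SI_compose[OF h, of "\<lambda>d. fst d + snd d" x] by (simp add: h_def P_def)
    also have "\<dots> = SI f x + SI g x"
      unfolding f_eq g_eq sum.distrib[symmetric] by (intro sum.cong refl scalar_op_add mem)
    finally show "SI (\<lambda>w. f w + g w) x = (SI f + SI g) x"
      by (simp add: blinfun.add_left)
  qed
  show "SI (\<lambda>w. f w - g w) = SI f - SI g"
  proof (rule blinfun_eqI)
    fix x
    have "SI (\<lambda>w. f w - g w) x = (\<Sum>d\<in>h ` \<Omega>. scalar_op (fst d - snd d) (P d x))"
      using SI_compose[OF h, of "\<lambda>d. fst d - snd d" x] by (simp add: h_def P_def)
    also have "\<dots> = SI f x - SI g x"
      unfolding f_eq g_eq sum_subtractf[symmetric] by (intro sum.cong refl scalar_op_diff mem)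
    finally show "SI (\<lambda>w. f w - g w) x = (SI f - SI g) x"
      by (simp add: blinfun.diff_left)
  qed
  show "SI (\<lambda>w. f w * g w) = SI f o\<^sub>L SI g"
  proof (rule blinfun_eqI)
    fix x
    \<comment> \<open>Distinct fibre projections annihilate each other, so the double sum of the
      operator product collapses to its diagonal.\<close>
    have diag: "P c (SI g x) = scalar_op (snd c) (P c x)" if "c \<in> h ` \<Omega>" for c
    proof -
      have "P c (SI g x) = (\<Sum>d\<in>h ` \<Omega>. scalar_op (snd d) (P c (P d x)))"
        unfolding g_eq blinfun.sum_right P_def by (intro sum.cong refl scalar_op_E[symmetric] sets)
      also have "\<dots> = (\<Sum>d\<in>h ` \<Omega>. if d = c then scalar_op (snd c) (P c x) else 0)"
      proof (intro sum.cong refl)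
        fix d
        have "P c (P d x) = (if d = c then P c x else 0)"
          unfolding P_def using sets(2)[of c] sets(2)[of d] by (auto intro!: E_idem E_disjoint)
        then show "scalar_op (snd d) (P c (P d x)) = (if d = c then scalar_op (snd c) (P c x) else 0)"
          by (simp add: blinfun.zero_right)
      qed
      finally show ?thesis
        using that sets(1) by simp
    qed
    have "SI (\<lambda>w. f w * g w) x = (\<Sum>d\<in>h ` \<Omega>. scalar_op (fst d * snd d) (P d x))"
      using SI_compose[OF h, of "\<lambda>d. fst d * snd d" x] by (simp add: h_def P_def)
    also have "\<dots> = SI f (SI g x)"
      unfolding f_eq[of "SI g x"] by (intro sum.cong refl) (simp add: scalar_op_mult mem diag)
    finally show "SI (\<lambda>w. f w * g w) x = (SI f o\<^sub>L SI g) x"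
      by simp
  qed
qed

lemma SI_cconj:
  assumes "simple f" "f ` \<Omega> \<subseteq> cplane \<II>"
  shows "SI f x \<bullet> y = x \<bullet> SI (\<lambda>w. cconj (f w)) y"
  unfolding SI_compose[OF assms(1)] SI_apply[OF assms(1)] inner_sum_left inner_sum_right
  using assms(2) simpleD(2)[OF assms(1)]
  by (intro sum.cong refl) (auto simp: scalar_op_cconj E_selfadjoint scalar_op_E)

text \<open>Moving \<open>J\<close> onto \<open>x\<close> by commutation leaves only set functions
  of the single form \<open>E M v \<bullet> z\<close>, to which one Hahn decomposition argument
  applies.\<close>

lemma SI_inner:
  assumes "simple f"
  shows "SI f x \<bullet> z = (\<Sum>c\<in>f ` \<Omega>. cre c * (E (f -` {c} \<inter> \<Omega>) x \<bullet> z)) +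
    (\<Sum>c\<in>f ` \<Omega>. cim \<II> c * (E (f -` {c} \<inter> \<Omega>) (J x) \<bullet> z))"
  unfolding SI_apply[OF assms] inner_sum_left sum.distrib[symmetric]
  using simpleD(2)[OF assms]
  by (intro sum.cong refl) (simp add: scalar_op_apply inner_simps E_J)

lemma right_linear_SI:
  assumes "simple f"
  shows "right_linear (SI f)"
proof -
  have id: "right_linear (id_blinfun :: ('h, 'n) coperator)"
    by (simp add: right_linear_def)
  have zero: "right_linear (0 :: ('h, 'n) coperator)"
    using right_linear_comb(1)[OF id id, of 0] by simp
  have "right_linear (\<Sum>c\<in>S. scalar_op c o\<^sub>L E (f -` {c} \<inter> \<Omega>))" for S
    by (induction S rule: infinite_finite_induct)
      (simp_all add: zero scalar_op_def right_linear_comb id right_linear_J right_linear_E simpleD[OF assms])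
  then show ?thesis
    by (simp add: SI_eq[OF assms])
qed

lemma SI_const: "SI (\<lambda>w. c) = scalar_op c"
proof (rule blinfun_eqI)
  fix x
  show "SI (\<lambda>w. c) x = scalar_op c x"
  proof (cases "\<Omega> = {}")
    case True
    \<comment> \<open>Over an empty \<Omega> the sum defining \<open>SI\<close> is empty, but
      \<open>E \<Omega>\<close> is both the identity and 0, so the module is trivial.\<close>
    then have "x = 0"
      using E_space[of x] E_empty[of x] by simp
    then show ?thesis
      by (simp add: blinfun.zero_right)
  next
    case False
    then have "(\<lambda>w. c) ` \<Omega> = {c}" "(\<lambda>w. c) -` {c} \<inter> \<Omega> = \<Omega>"
      by auto
    then show ?thesis
      by (simp add: SI_apply E_space)
  qed
qed

text \<open>These are the first two conjuncts under the quantifier of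
  \<open>spectral_integral\<close>. Later lemmas assume such a sequence instead of measurability,
  because sequences can be added, multiplied and conjugated termwise.\<close>

definition approximates :: "(nat \<Rightarrow> 'w \<Rightarrow> 'n clifford) \<Rightarrow> ('w \<Rightarrow> 'n clifford) \<Rightarrow> bool"
  where "approximates F f \<longleftrightarrow>
    (\<forall>k. simple (F k) \<and> F k ` \<Omega> \<subseteq> cplane \<II>) \<and> uniform_limit \<Omega> F f sequentially"

lemma approximatesD:
  assumes "approximates F f"
  shows "simple (F k)" "F k ` \<Omega> \<subseteq> cplane \<II>" "uniform_limit \<Omega> F f sequentially"
  using assms by (auto simp: approximates_def)

lemma SI_norm_diff_le:
  assumes f: "simple f" "f ` \<Omega> \<subseteq> cplane \<II>" and g: "simple g" "g ` \<Omega> \<subseteq> cplane \<II>"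
    and B: "0 \<le> B" "\<And>w. w \<in> \<Omega> \<Longrightarrow> norm (f w - g w) \<le> B"
  shows "norm (SI f - SI g) \<le> B"
proof -
  have "simple (\<lambda>w. f w - g w)"
    using f(1) g(1) by (rule simple_function_diff)
  moreover have "(\<lambda>w. f w - g w) ` \<Omega> \<subseteq> cplane \<II>"
    using f(2) g(2) cplane_diff[OF \<II>] by (auto simp: image_subset_iff)
  ultimately show ?thesis
    unfolding SI_diff[OF f g, symmetric] using B by (intro norm_blinfun_bound SI_norm_le)
qed

lemma approximates_SI_convergent:
  assumes "approximates F f"
  shows "convergent (\<lambda>k. SI (F k))"
proof (intro blinfun_Cauchy_convergent metric_CauchyI)
  fix e :: real
  assume "0 < e"
  \<comment> \<open>Two functions within e / 4 of \<open>f\<close> differ by at most e / 2;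
    \<open>SI_norm_diff_le\<close> gives only a weak inequality, so room is left below
    \<open>e\<close>.\<close>
  then have "\<forall>\<^sub>F k in sequentially. \<forall>w\<in>\<Omega>. dist (F k w) (f w) < e / 4"
    using approximatesD(3)[OF assms] by (intro uniform_limitD) auto
  then obtain N where N: "\<And>k w. k \<ge> N \<Longrightarrow> w \<in> \<Omega> \<Longrightarrow> dist (F k w) (f w) < e / 4"
    by (auto simp: eventually_sequentially)
  have "dist (SI (F i)) (SI (F j)) < e" if "i \<ge> N" "j \<ge> N" for i j
  proof -
    have "norm (F i w - F j w) \<le> e / 2" if "w \<in> \<Omega>" for w
      using N[OF \<open>i \<ge> N\<close> that] N[OF \<open>j \<ge> N\<close> that] dist_triangle2[of "F i w" "F j w" "f w"]
      by (simp add: dist_norm)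
    then have "norm (SI (F i) - SI (F j)) \<le> e / 2"
      using \<open>0 < e\<close> by (intro SI_norm_diff_le approximatesD[OF assms]) auto
    then show ?thesis
      using \<open>0 < e\<close> by (simp add: dist_norm)
  qed
  then show "\<exists>N. \<forall>i\<ge>N. \<forall>j\<ge>N. dist (SI (F i)) (SI (F j)) < e"
    by blast
qed

text \<open>Two sequences approaching the same \<open>f\<close> uniformly become uniformly close to
  each other. This supplies the uniqueness of the spectral integral.\<close>

lemma approximates_SI_diff:
  assumes F: "approximates F f" and G: "approximates G f"
  shows "(\<lambda>k. SI (F k) - SI (G k)) \<longlonglongrightarrow> 0"
proof (rule tendstoI)
  fix e :: real
  assume "0 < e"
  then have "\<forall>\<^sub>F k in sequentially. \<forall>w\<in>\<Omega>. dist (F k w) (f w) < e / 4"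
    "\<forall>\<^sub>F k in sequentially. \<forall>w\<in>\<Omega>. dist (G k w) (f w) < e / 4"
    using approximatesD(3)[OF F] approximatesD(3)[OF G] by (intro uniform_limitD; simp)+
  then show "\<forall>\<^sub>F k in sequentially. dist (SI (F k) - SI (G k)) 0 < e"
  proof eventually_elim
    case (elim k)
    have "norm (F k w - G k w) \<le> e / 2" if "w \<in> \<Omega>" for w
      using elim that dist_triangle2[of "F k w" "G k w" "f w"] by (force simp: dist_norm)
    then have "norm (SI (F k) - SI (G k)) \<le> e / 2"
      using \<open>0 < e\<close> by (intro SI_norm_diff_le approximatesD[OF F] approximatesD[OF G]) auto
    then show ?case
      using \<open>0 < e\<close> by simp
  qed
qed

text \<open>Evaluates the definite description; afterwards every property of the integral is the
  limit of its counterpart for simple functions.\<close>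

lemma spectral_int_tendsto:
  assumes F: "approximates F f"
  shows "(\<lambda>k. SI (F k)) \<longlonglongrightarrow> spectral_int f"
proof -
  obtain T where T: "(\<lambda>k. SI (F k)) \<longlonglongrightarrow> T"
    using approximates_SI_convergent[OF F] by (auto simp: convergent_def)
  have "spectral_int f = T"
    unfolding spectral_integral_def approximates_def[symmetric]
      conj_assoc[symmetric]
  proof (rule the_equality)
    show "\<exists>F. approximates F f \<and> (\<lambda>k. SI (F k)) \<longlonglongrightarrow> T"
      using F T by blast
  next
    fix T'
    assume "\<exists>G. approximates G f \<and> (\<lambda>k. SI (G k)) \<longlonglongrightarrow> T'"
    then obtain G where G: "approximates G f" "(\<lambda>k. SI (G k)) \<longlonglongrightarrow> T'"
      by blast
    have "(\<lambda>k. SI (F k) - SI (G k)) \<longlonglongrightarrow> T - T'"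
      by (intro tendsto_diff T G)
    then show "T' = T"
      using LIMSEQ_unique[OF approximates_SI_diff[OF F G(1)]] by fastforce
  qed
  with T show ?thesis
    by simp
qed

lemma approximates_mem:
  assumes "approximates F f" "w \<in> \<Omega>"
  shows "f w \<in> cplane \<II>"
proof (rule closed_sequentially[OF closed_cplane[OF \<II>]])
  show "(\<lambda>k. F k w) \<longlonglongrightarrow> f w"
    using approximatesD(3)[OF assms(1)] assms(2) by (rule tendsto_uniform_limitI)
  show "F k w \<in> cplane \<II>" for k
    using approximatesD(2)[OF assms(1)] assms(2) by blast
qed

lemma approximates_bounded:
  assumes "approximates F f"
  shows "bounded (f ` \<Omega>)"
proof -
  have "\<forall>\<^sub>F k in sequentially. \<forall>w\<in>\<Omega>. dist (F k w) (f w) < 1"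
    using approximatesD(3)[OF assms] by (rule uniform_limitD) simp
  then obtain k where k: "\<And>w. w \<in> \<Omega> \<Longrightarrow> dist (F k w) (f w) < 1"
    by (auto simp: eventually_sequentially)
  have "bounded (F k ` \<Omega>)"
    using simpleD(1)[OF approximatesD(1)[OF assms]] by (rule finite_imp_bounded)
  then obtain B where B: "\<And>w. w \<in> \<Omega> \<Longrightarrow> norm (F k w) \<le> B"
    by (auto simp: bounded_iff)
  have "norm (f w) \<le> B + 1" if "w \<in> \<Omega>" for w
    using k[OF that] B[OF that] norm_triangle_ineq2[of "f w" "F k w"]
    by (simp add: dist_norm norm_minus_commute)
  then show ?thesis
    by (auto simp: bounded_iff)
qed

lemma approximates_const: "c \<in> cplane \<II> \<Longrightarrow> approximates (\<lambda>_ _. c) (\<lambda>_. c)"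
  by (auto simp: approximates_def intro: uniform_limit_const)

text \<open>For products, uniform convergence passes to the limit because both limit functions are
  bounded.\<close>

lemma approximates_binary:
  assumes "approximates F f" "approximates G g"
  shows approximates_add: "approximates (\<lambda>k w. F k w + G k w) (\<lambda>w. f w + g w)"
    and approximates_diff: "approximates (\<lambda>k w. F k w - G k w) (\<lambda>w. f w - g w)"
    and approximates_mult: "approximates (\<lambda>k w. F k w * G k w) (\<lambda>w. f w * g w)"
  using approximatesD[OF assms(1)] approximatesD[OF assms(2)]
    approximates_bounded[OF assms(1)] approximates_bounded[OF assms(2)]
    cplane_add[OF \<II>] cplane_diff[OF \<II>] cplane_mult[OF \<II>]
  by (auto simp: approximates_def image_subset_iff
      intro!: simple_function_add simple_function_diff simple_function_mult uniform_limit_add uniform_limit_minus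
        bounded_bilinear.bounded_uniform_limit[OF bounded_bilinear_clifford_mult])

lemma bounded_linear_cconj: "bounded_linear (cconj :: 'n clifford \<Rightarrow> 'n clifford)"
  by (intro linear_conv_bounded_linear[THEN iffD1] linearI) (simp_all add: cconj_linear)

lemma approximates_cconj:
  assumes "approximates F f"
  shows "approximates (\<lambda>k w. cconj (F k w)) (\<lambda>w. cconj (f w))"
  using approximatesD[OF assms] cplane_cconj[OF \<II>]
  by (auto simp: approximates_def image_subset_iff
      intro!: simple_function_compose1[of _ _ cconj] bounded_linear.uniform_limit[OF bounded_linear_cconj])

lemma
  assumes F: "approximates F f" and G: "approximates G g"
  shows spectral_int_add: "spectral_int (\<lambda>w. f w + g w) = spectral_int f + spectral_int g"
    and spectral_int_diff: "spectral_int (\<lambda>w. f w - g w) = spectral_int f - spectral_int g"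
    and spectral_int_mult: "spectral_int (\<lambda>w. f w * g w) = spectral_int f o\<^sub>L spectral_int g"
proof -
  note FG = approximatesD(1,2)[OF F] approximatesD(1,2)[OF G]
  note lim = spectral_int_tendsto[OF F] spectral_int_tendsto[OF G]
  show "spectral_int (\<lambda>w. f w + g w) = spectral_int f + spectral_int g"
    using spectral_int_tendsto[OF approximates_add[OF F G]] tendsto_add[OF lim]
    by (intro LIMSEQ_unique) (simp_all add: SI_add FG)
  show "spectral_int (\<lambda>w. f w - g w) = spectral_int f - spectral_int g"
    using spectral_int_tendsto[OF approximates_diff[OF F G]] tendsto_diff[OF lim]
    by (intro LIMSEQ_unique) (simp_all add: SI_diff FG)
  show "spectral_int (\<lambda>w. f w * g w) = spectral_int f o\<^sub>L spectral_int g"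
    using spectral_int_tendsto[OF approximates_mult[OF F G]]
      bounded_bilinear.tendsto[OF bounded_bilinear_blinfun_compose lim]
    by (intro LIMSEQ_unique) (simp_all add: SI_mult FG)
qed

lemma spectral_int_const: "c \<in> cplane \<II> \<Longrightarrow> spectral_int (\<lambda>_. c) = scalar_op c"
  using spectral_int_tendsto[OF approximates_const[of c]] by (simp add: SI_const LIMSEQ_const_iff)

lemma tendsto_apply:
  assumes "approximates F f"
  shows "(\<lambda>k. SI (F k) x) \<longlonglongrightarrow> spectral_int f x"
  by (rule blinfun.tendsto[OF spectral_int_tendsto[OF assms] tendsto_const])

lemma spectral_int_cconj_inner:
  assumes "approximates F f"
  shows "spectral_int f x \<bullet> y = x \<bullet> spectral_int (\<lambda>w. cconj (f w)) y"
proof (rule LIMSEQ_unique)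
  show "(\<lambda>k. SI (F k) x \<bullet> y) \<longlonglongrightarrow> spectral_int f x \<bullet> y"
    by (intro tendsto_intros tendsto_apply assms)
  show "(\<lambda>k. SI (F k) x \<bullet> y) \<longlonglongrightarrow> x \<bullet> spectral_int (\<lambda>w. cconj (f w)) y"
    unfolding SI_cconj[OF approximatesD(1,2)[OF assms]]
    by (intro tendsto_intros tendsto_apply approximates_cconj assms)
qed

lemma tendsto_rmult:
  assumes "(f \<longlongrightarrow> (x :: ('h, 'n) cmodule)) net"
  shows "((\<lambda>k. rmult (f k) a) \<longlongrightarrow> rmult x a) net"
  unfolding rmult_def by (intro tendsto_vec_lambda tendsto_intros tendsto_vec_nth assms)

lemma right_linear_spectral_int:
  assumes "approximates F f"
  shows "right_linear (spectral_int f)"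
  unfolding right_linear_def
proof (intro allI)
  fix x a
  have "(\<lambda>k. rmult (SI (F k) x) a) \<longlonglongrightarrow> rmult (spectral_int f x) a"
    by (intro tendsto_rmult tendsto_apply assms)
  moreover have "rmult (SI (F k) x) a = SI (F k) (rmult x a)" for k
    using right_linear_SI[OF approximatesD(1)[OF assms]] by (simp add: right_linear_def)
  ultimately show "spectral_int f (rmult x a) = rmult (spectral_int f x) a"
    using tendsto_apply[OF assms, of "rmult x a"] by (simp add: LIMSEQ_unique)
qed

lemma spectral_int_adj:
  assumes "approximates F f"
  shows "spectral_int (\<lambda>w. cconj (f w)) = adj (spectral_int f)"
  using adj_eqI(1)[OF right_linear_spectral_int[OF assms] spectral_int_cconj_inner[OF assms]] by simp

end

section \<open>Signed measures and the integral representation\<close>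

text \<open>A bounded function has only finitely many integer parts. Applied to multiples of a
  function, this yields simple functions uniformly close to it.\<close>

lemma simple_function_floor:
  fixes g :: "'a \<Rightarrow> real"
  assumes "g \<in> borel_measurable M" "\<And>w. w \<in> space M \<Longrightarrow> \<bar>g w\<bar> \<le> B"
  shows "simple_function M (\<lambda>w. real_of_int \<lfloor>g w\<rfloor>)"
proof (rule simple_function_borel_measurable)
  show "(\<lambda>w. real_of_int \<lfloor>g w\<rfloor>) \<in> borel_measurable M"
    using assms(1) by measurable
  have "(\<lambda>w. real_of_int \<lfloor>g w\<rfloor>) ` space M \<subseteq> real_of_int ` {\<lfloor>- B\<rfloor>..\<lfloor>B\<rfloor>}"
    using assms(2) by (fastforce intro: floor_mono simp: abs_le_iff)
  then show "finite ((\<lambda>w. real_of_int \<lfloor>g w\<rfloor>) ` space M)"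
    by (rule finite_subset) simp
qed

text \<open>Summing over the fibres of \<open>F\<close>, rather than over the values of
  \<open>u\<close>, produces sums indexed exactly as in \<open>SI_inner\<close>.\<close>

lemma (in finite_measure) integral_simple_compose:
  fixes u :: "'b \<Rightarrow> real"
  assumes F: "simple_function M F"
  shows "integrable M (\<lambda>w. u (F w))"
    and "(\<integral>w. u (F w) \<partial>M) = (\<Sum>c\<in>F ` space M. u c * measure M (F -` {c} \<inter> space M))"
proof -
  note F = simple_functionD[OF F]
  have eq: "u (F w) = (\<Sum>c\<in>F ` space M. u c * indicator (F -` {c} \<inter> space M) w)" if "w \<in> space M" for w
    using that F(1) by (subst sum.remove[of _ "F w"]) (auto intro!: sum.neutral simp: indicator_def)
  have int: "integrable M (\<lambda>w. u c * indicator (F -` {c} \<inter> space M) w)" for c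
    using F(2)[of "{c}"] by (intro integrable_mult_right) (simp add: emeasure_eq_measure)
  show "integrable M (\<lambda>w. u (F w))"
    using int by (subst Bochner_Integration.integrable_cong[OF refl eq]) auto
  have "(\<integral>w. u (F w) \<partial>M) = (\<integral>w. (\<Sum>c\<in>F ` space M. u c * indicator (F -` {c} \<inter> space M) w) \<partial>M)"
    by (intro Bochner_Integration.integral_cong eq refl)
  also have "\<dots> = (\<Sum>c\<in>F ` space M. u c * measure M (F -` {c} \<inter> space M))"
    using int F(2) by (subst Bochner_Integration.integral_sum) (auto simp: Int_absorb1)
  finally show "(\<integral>w. u (F w) \<partial>M) = \<dots>" .
qed

lemma (in finite_measure) integral_uniform_limit:
  fixes g :: "'a \<Rightarrow> real"
  assumes int: "\<And>k. integrable M (f k)" and lim: "uniform_limit (space M) f g sequentially"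
  shows "(\<lambda>k. integral\<^sup>L M (f k)) \<longlonglongrightarrow> integral\<^sup>L M g"
proof (rule tendstoI)
  fix e :: real
  assume "0 < e"
  \<comment> \<open>The added 1 keeps the denominator positive even for the zero measure.\<close>
  define d where "d = e / (2 * (measure M (space M) + 1))"
  have d: "0 < d" "d * measure M (space M) < e"
    using \<open>0 < e\<close> measure_nonneg[of M "space M"]
    by (auto simp: d_def field_simps add_pos_nonneg intro: add_nonneg_pos)
  have g: "g \<in> borel_measurable M"
    using borel_measurable_integrable[OF int] tendsto_uniform_limitI[OF lim]
    by (rule borel_measurable_LIMSEQ_real[rotated])
  show "\<forall>\<^sub>F k in sequentially. dist (integral\<^sup>L M (f k)) (integral\<^sup>L M g) < e"
    using uniform_limitD[OF lim d(1)]
  proof eventually_elim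
    case (elim k)
    \<comment> \<open>The difference is bounded by \<open>d\<close> on a finite measure space; its
      integrability transfers integrability from \<open>f k\<close> to \<open>g\<close>.\<close>
    have int_diff: "integrable M (\<lambda>w. f k w - g w)"
      using g borel_measurable_integrable[OF int] elim
      by (intro integrable_const_bound[of _ d]) (auto simp: dist_real_def intro!: AE_I2 less_imp_le)
    from Bochner_Integration.integrable_diff[OF int[of k] this] have "integrable M g"
      by simp
    then have "integral\<^sup>L M (f k) - integral\<^sup>L M g = (\<integral>w. f k w - g w \<partial>M)"
      using int by simp
    also have "\<bar>\<dots>\<bar> \<le> (\<integral>w. \<bar>f k w - g w\<bar> \<partial>M)"
      by (rule integral_abs_bound)
    also have "\<dots> \<le> (\<integral>w. d \<partial>M)"
      using elim int_diff by (intro integral_mono) (auto simp: dist_real_def intro: less_imp_le)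
    also have "\<dots> < e"
      using d(2) by (simp add: mult.commute)
    finally show ?case
      by (simp add: dist_real_def)
  qed
qed

locale finite_signed_measure = sigma_algebra +
  fixes \<nu> :: "'a set \<Rightarrow> real"
  assumes sums: "range A \<subseteq> M \<Longrightarrow> disjoint_family A \<Longrightarrow> (\<lambda>k. \<nu> (A k)) sums \<nu> (\<Union>k. A k)"
begin

lemma empty: "\<nu> {} = 0"
proof -
  have "(\<lambda>k. \<nu> {}) sums \<nu> {}"
    using sums[of "\<lambda>_. {}"] by (simp add: disjoint_family_on_def)
  then have "(\<lambda>k :: nat. \<nu> {}) \<longlonglongrightarrow> 0"
    by (intro summable_LIMSEQ_zero) (auto simp: sums_iff)
  then show ?thesis
    by (simp add: LIMSEQ_const_iff)
qed

lemma additive: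
  assumes "A \<in> M" "B \<in> M" "A \<inter> B = {}"
  shows "\<nu> (A \<union> B) = \<nu> A + \<nu> B"
proof -
  have "(\<lambda>k. \<nu> (binaryset A B k)) sums \<nu> (\<Union>k. binaryset A B k)"
    using assms by (intro sums) (auto simp: range_binaryset_eq disjoint_family_on_def binaryset_def)
  moreover have "(\<lambda>k. \<nu> (binaryset A B k)) sums (\<Sum>k<2. \<nu> (binaryset A B k))"
    by (rule sums_finite) (auto simp: binaryset_def empty)
  ultimately have "\<nu> (\<Union>k. binaryset A B k) = (\<Sum>k<2. \<nu> (binaryset A B k))"
    by (rule sums_unique2)
  then show ?thesis
    by (simp add: UN_binaryset_eq binaryset_def numeral_2_eq_2)
qed

lemma split: "A \<in> M \<Longrightarrow> Y \<in> M \<Longrightarrow> \<nu> A = \<nu> (A \<inter> Y) + \<nu> (A - Y)"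
  using additive[of "A \<inter> Y" "A - Y"] by (auto simp: Int_Diff_Un)

lemma measure_of_nonneg:
  assumes "\<And>A. A \<in> M \<Longrightarrow> 0 \<le> \<nu> A"
  defines "m \<equiv> measure_of \<Omega> M (\<lambda>A. ennreal (\<nu> A))"
  shows "space m = \<Omega>" "sets m = M" "\<And>A. A \<in> M \<Longrightarrow> emeasure m A = ennreal (\<nu> A)"
    "\<And>A. A \<in> M \<Longrightarrow> measure m A = \<nu> A" "finite_measure m"
proof -
  show sp: "space m = \<Omega>" and se: "sets m = M"
    by (simp_all add: m_def)
  show em: "emeasure m A = ennreal (\<nu> A)" if "A \<in> M" for A
  proof (rule emeasure_measure_of[OF m_def[THEN meta_eq_to_obj_eq]])
    show "M \<subseteq> Pow \<Omega>"
      by (rule space_closed)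
    show "A \<in> sets m"
      using that se by simp
    show "positive (sets m) (\<lambda>A. ennreal (\<nu> A))"
      by (simp add: positive_def empty)
    show "countably_additive (sets m) (\<lambda>A. ennreal (\<nu> A))"
      unfolding se
    proof (intro countably_additiveI suminf_ennreal_eq)
      fix A :: "nat \<Rightarrow> 'a set" and i
      assume A: "range A \<subseteq> M" "disjoint_family A"
      show "0 \<le> \<nu> (A i)"
        using A(1) by (intro assms(1)) auto
      show "(\<lambda>k. \<nu> (A k)) sums \<nu> (\<Union>k. A k)"
        using A by (rule sums)
    qed
  qed
  then show "measure m A = \<nu> A" if "A \<in> M" for A
    using that assms(1) by (simp add: measure_def)
  show "finite_measure m"
    using em by (intro finite_measureI) (simp add: sp)
qed

text \<open>Cutting \<open>B\<close> down to \<open>Y\<close> discards a set of nonpositive measure,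
  and enlarging \<open>B \<inter> Y\<close> to \<open>A \<inter> Y\<close> adds one of nonnegative
  measure. So the supremum is attained at \<open>A \<inter> Y\<close>.\<close>

lemma pos_variation_Hahn:
  assumes Y: "Y \<in> M" "\<forall>A\<in>M. A \<subseteq> Y \<longrightarrow> 0 \<le> \<nu> A" "\<forall>A\<in>M. A \<inter> Y = {} \<longrightarrow> \<nu> A \<le> 0"
  shows "sets (pos_variation \<Omega> M \<nu>) = M" "finite_measure (pos_variation \<Omega> M \<nu>)"
    "A \<in> M \<Longrightarrow> measure (pos_variation \<Omega> M \<nu>) A = \<nu> (A \<inter> Y)"
proof -
  interpret Y: finite_signed_measure \<Omega> M "\<lambda>A. \<nu> (A \<inter> Y)"
  proof
    fix A :: "nat \<Rightarrow> 'a set"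
    assume "range A \<subseteq> M" "disjoint_family A"
    then have "(\<lambda>k. \<nu> (A k \<inter> Y)) sums \<nu> (\<Union>k. A k \<inter> Y)"
      using Y(1) by (intro sums) (auto simp: disjoint_family_on_def)
    then show "(\<lambda>k. \<nu> (A k \<inter> Y)) sums \<nu> ((\<Union>k. A k) \<inter> Y)"
      by simp
  qed
  have "(SUP B\<in>{B \<in> M. B \<subseteq> A}. ennreal (\<nu> B)) = ennreal (\<nu> (A \<inter> Y))" if A: "A \<in> M" for A
  proof (rule SUP_eqI)
    fix B
    assume "B \<in> {B \<in> M. B \<subseteq> A}"
    then have B: "B \<in> M" "B \<subseteq> A"
      by auto
    have "\<nu> B \<le> \<nu> (B \<inter> Y)"
      using split[OF B(1) Y(1)] Y(3)[rule_format, of "B - Y"] B Y(1) by auto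
    also have "\<dots> \<le> \<nu> (A \<inter> Y)"
    proof -
      have "A \<inter> Y \<inter> B = B \<inter> Y"
        using B by auto
      then show ?thesis
        using split[OF Int[OF A Y(1)] B(1)] Y(2)[rule_format, OF Diff[OF Int[OF A Y(1)] B(1)]] by auto
    qed
    finally show "ennreal (\<nu> B) \<le> ennreal (\<nu> (A \<inter> Y))"
      by (rule ennreal_leI)
  next
    fix y
    assume "\<And>B. B \<in> {B \<in> M. B \<subseteq> A} \<Longrightarrow> ennreal (\<nu> B) \<le> y"
    then show "ennreal (\<nu> (A \<inter> Y)) \<le> y"
      using A Y(1) by auto
  qed
  then have eq: "pos_variation \<Omega> M \<nu> = measure_of \<Omega> M (\<lambda>A. ennreal (\<nu> (A \<inter> Y)))"
    unfolding pos_variation_def by (intro measure_of_eq space_closed) (simp add: sigma_sets_eq)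
  have nonneg: "\<And>A. A \<in> M \<Longrightarrow> 0 \<le> \<nu> (A \<inter> Y)"
    using Y by auto
  show "sets (pos_variation \<Omega> M \<nu>) = M" "finite_measure (pos_variation \<Omega> M \<nu>)"
    "A \<in> M \<Longrightarrow> measure (pos_variation \<Omega> M \<nu>) A = \<nu> (A \<inter> Y)"
    unfolding eq using Y.measure_of_nonneg[OF nonneg] by auto
qed

end

lemma pos_variation_cong:
  assumes "\<And>A. A \<in> \<A> \<Longrightarrow> \<mu> A = \<nu> A"
  shows "pos_variation \<Omega> \<A> \<mu> = pos_variation \<Omega> \<A> \<nu>"
proof -
  have "(SUP B\<in>{B \<in> \<A>. B \<subseteq> A}. ennreal (\<mu> B)) = (SUP B\<in>{B \<in> \<A>. B \<subseteq> A}. ennreal (\<nu> B))" for A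
    using assms by (intro SUP_cong) auto
  then show ?thesis
    by (simp add: pos_variation_def)
qed

text \<open>The variations sample the set function only on the \<sigma>-algebra. That is where
  \<open>J (E M x)\<close> may be replaced by \<open>E M (J x)\<close>.\<close>

lemma signed_integral_cong:
  assumes "\<And>A. A \<in> \<A> \<Longrightarrow> \<mu> A = \<nu> A"
  shows "signed_integral \<Omega> \<A> \<mu> h = signed_integral \<Omega> \<A> \<nu> h"
  using pos_variation_cong[of \<A> \<mu> \<nu> \<Omega>] pos_variation_cong[of \<A> "\<lambda>A. - \<mu> A" "\<lambda>A. - \<nu> A" \<Omega>] assms
  by (simp add: signed_integral_def)

section \<open>Approximation of bounded measurable functions and the scalar measures of
  \<open>E\<close>\<close>

context spectral_calculus
begin

lemma bounded_measurable_approximates: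
  assumes "f \<in> bounded_measurable \<Omega> \<A> \<II>"
  obtains F where "approximates F f"
proof -
  have f: "f \<in> borel_measurable (sigma \<Omega> \<A>)" "\<And>w. w \<in> \<Omega> \<Longrightarrow> f w \<in> cplane \<II>" "bounded (f ` \<Omega>)"
    using assms by (auto simp: bounded_measurable_def)
  then obtain B where B: "\<And>w. w \<in> \<Omega> \<Longrightarrow> norm (f w) \<le> B"
    by (auto simp: bounded_iff)
  \<comment> \<open>Rounding down to the grid of step 1 / (k + 1); the error bound does not depend
    on \<open>r\<close>.\<close>
  define q where "q k r = real_of_int \<lfloor>real (Suc k) * r\<rfloor> / real (Suc k)" for k r
  have q: "\<bar>q k r - r\<bar> \<le> 1 / Suc k" for k r
  proof -
    have "q k r - r = (real_of_int \<lfloor>real (Suc k) * r\<rfloor> - real (Suc k) * r) / real (Suc k)"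
      by (simp add: q_def field_simps)
    moreover have "\<bar>real_of_int \<lfloor>real (Suc k) * r\<rfloor> - real (Suc k) * r\<bar> \<le> 1"
      by linarith
    ultimately show ?thesis
      by (simp add: divide_right_mono del: of_nat_Suc)
  qed
  have simple_q: "simple (\<lambda>w. q k (g w))"
    if "g \<in> borel_measurable (sigma \<Omega> \<A>)" "\<And>w. w \<in> \<Omega> \<Longrightarrow> \<bar>g w\<bar> \<le> B" for g k
  proof -
    have "simple (\<lambda>w. real_of_int \<lfloor>real (Suc k) * g w\<rfloor>)"
      using that
      by (intro simple_function_floor[of _ _ "real (Suc k) * B"]) (auto simp: abs_mult intro!: mult_left_mono)
    then show ?thesis
      unfolding q_def by (rule simple_function_compose1)
  qed
  \<comment> \<open>Rounding the two plane coordinates, not all Clifford coefficients, keeps the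
    approximation in the plane.\<close>
  define F where "F k w = q k (cre (f w)) *\<^sub>R 1 + q k (f w \<bullet> \<II>) *\<^sub>R \<II>" for k w
  have "simple (F k)" for k
  proof -
    have "(\<lambda>w. cre (f w)) \<in> borel_measurable (sigma \<Omega> \<A>)"
      using f(1) by (rule measurable_compose)
        (intro borel_measurable_continuous_onI bounded_linear.continuous_on[OF bounded_linear_cre]
          continuous_on_id)
    moreover have "\<bar>cre (f w)\<bar> \<le> B" "\<bar>f w \<bullet> \<II>\<bar> \<le> B" if "w \<in> \<Omega>" for w
    proof -
      have "(norm (f w))\<^sup>2 = (cre (f w))\<^sup>2 + (f w \<bullet> \<II>)\<^sup>2"
        using norm_cplane[OF \<II> f(2)[OF that]] cim_eq_inner[OF \<II> f(2)[OF that]] by simp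
      then have "(cre (f w))\<^sup>2 \<le> (norm (f w))\<^sup>2" "(f w \<bullet> \<II>)\<^sup>2 \<le> (norm (f w))\<^sup>2"
        by simp_all
      then have "\<bar>cre (f w)\<bar> \<le> norm (f w)" "\<bar>f w \<bullet> \<II>\<bar> \<le> norm (f w)"
        by (simp_all flip: abs_le_square_iff)
      then show "\<bar>cre (f w)\<bar> \<le> B" "\<bar>f w \<bullet> \<II>\<bar> \<le> B"
        using B[OF that] by auto
    qed
    ultimately have "simple (\<lambda>w. q k (cre (f w)))" "simple (\<lambda>w. q k (f w \<bullet> \<II>))"
      using f(1) by (intro simple_q borel_measurable_inner; simp)+
    then show ?thesis
      unfolding F_def by (rule simple_function_compose2)
  qed
  moreover have "uniform_limit \<Omega> F f sequentially"
  proof (rule uniform_limitI)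
    fix e :: real
    assume "0 < e"
    then obtain N where N: "1 / real (Suc N) < e / 2"
      using nat_approx_posE[of "e / 2"] by (metis half_gt_zero)
    have "dist (F k w) (f w) < e" if "k \<ge> N" "w \<in> \<Omega>" for k w
    proof -
      define s where "s = q k (cre (f w)) - cre (f w)"
      define t where "t = q k (f w \<bullet> \<II>) - f w \<bullet> \<II>"
      have f_eq: "f w = cre (f w) *\<^sub>R 1 + (f w \<bullet> \<II>) *\<^sub>R \<II>"
        using cplane_expansion[OF \<II> f(2)] cim_eq_inner[OF \<II> f(2)] that by metis
      have "F k w - f w = s *\<^sub>R 1 + t *\<^sub>R \<II>"
        unfolding s_def t_def F_def by (subst (3) f_eq) (simp add: algebra_simps)
      moreover have "norm (1 :: 'n clifford) = 1" "norm \<II> = 1"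
        by (simp_all add: norm_eq_sqrt_inner norm_imag[OF \<II>] inner_eq_cre[of 1 1] cconj_one)
      ultimately have "dist (F k w) (f w) \<le> \<bar>s\<bar> + \<bar>t\<bar>"
        using norm_triangle_ineq[of "s *\<^sub>R 1" "t *\<^sub>R \<II>"] by (simp add: dist_norm)
      moreover have "\<bar>s\<bar> \<le> 1 / Suc k" "\<bar>t\<bar> \<le> 1 / Suc k"
        unfolding s_def t_def by (rule q)+
      moreover have "1 / real (Suc k) \<le> 1 / real (Suc N)"
        using that by (simp add: field_simps)
      ultimately show ?thesis
        using N by linarith
    qed
    then show "\<forall>\<^sub>F k in sequentially. \<forall>w\<in>\<Omega>. dist (F k w) (f w) < e"
      by (auto simp: eventually_sequentially)
  qed
  ultimately show ?thesis
    using that[of F] by (auto simp: approximates_def F_def intro: cplaneI[OF \<II>])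
qed

lemma E_signed_measure: "finite_signed_measure \<Omega> \<A> (\<lambda>M. E M x \<bullet> z)"
  by unfold_locales (intro bounded_linear.sums[OF bounded_linear_inner_left] E_sums)

text \<open>Positive because \<open>E M x \<bullet> x\<close> is the squared norm of
  \<open>E M x\<close>. This is the integrator in the norm formula, and its total mass is the
  squared norm of \<open>x\<close>.\<close>

definition diag_measure :: "('h, 'n) cmodule \<Rightarrow> 'w measure"
  where "diag_measure x = measure_of \<Omega> \<A> (\<lambda>M. ennreal (E M x \<bullet> x))"

lemma
  shows space_diag_measure [simp]: "space (diag_measure x) = \<Omega>"
    and sets_diag_measure [simp]: "sets (diag_measure x) = \<A>"
    and emeasure_diag_measure: "M \<in> \<A> \<Longrightarrow> emeasure (diag_measure x) M = ennreal (E M x \<bullet> x)"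
    and measure_diag_measure: "M \<in> \<A> \<Longrightarrow> measure (diag_measure x) M = E M x \<bullet> x"
    and finite_diag_measure: "finite_measure (diag_measure x)"
  unfolding diag_measure_def
  by (rule finite_signed_measure.measure_of_nonneg[OF E_signed_measure]; simp add: E_norm)+

text \<open>By polarization the signed measure is a difference of two positive ones.\<close>

lemma E_Hahn_decomposition:
  obtains Y where "Y \<in> \<A>" "\<forall>A\<in>\<A>. A \<subseteq> Y \<longrightarrow> 0 \<le> E A x \<bullet> z"
    "\<forall>A\<in>\<A>. A \<inter> Y = {} \<longrightarrow> E A x \<bullet> z \<le> 0"
proof -
  define a where "a = (1/2) *\<^sub>R (x + z)"
  define b where "b = (1/2) *\<^sub>R (x - z)"
  \<comment> \<open>The squares cancel, and the two cross terms agree because \<open>E A\<close> is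
    self-adjoint.\<close>
  have polar: "E A x \<bullet> z = E A a \<bullet> a - E A b \<bullet> b" if "A \<in> \<A>" for A
    using E_selfadjoint[OF that, of z x]
    by (simp add: a_def b_def blinfun.bilinear_simps inner_simps inner_commute[of z] field_simps)
  have nonneg: "0 \<le> E A y \<bullet> y" if "A \<in> \<A>" for A y
    using that by (simp add: E_norm)
  obtain Y where "Y \<in> \<A>"
    "\<forall>A\<in>\<A>. A \<subseteq> Y \<longrightarrow> emeasure (diag_measure b) A \<le> emeasure (diag_measure a) A"
    "\<forall>A\<in>\<A>. A \<inter> Y = {} \<longrightarrow> emeasure (diag_measure a) A \<le> emeasure (diag_measure b) A"
    using finite_unsigned_Hahn_decomposition[OF finite_diag_measure[of a] finite_diag_measure[of b]]
    by auto
  then show ?thesis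
    using that[of Y] by (simp add: emeasure_diag_measure nonneg polar)
qed

text \<open>The complement of a Hahn set is a Hahn set for the negated measure. So \<open>P\<close>
  and \<open>N\<close> see \<open>A \<inter> Y\<close> and \<open>A - Y\<close>, and their
  difference recombines to the value at \<open>A\<close>.\<close>

lemma E_Jordan_decomposition:
  fixes x z
  defines "P \<equiv> pos_variation \<Omega> \<A> (\<lambda>M. E M x \<bullet> z)"
    and "N \<equiv> pos_variation \<Omega> \<A> (\<lambda>M. - (E M x \<bullet> z))"
  shows "sets P = \<A>" "sets N = \<A>" "finite_measure P" "finite_measure N"
    "\<And>A. A \<in> \<A> \<Longrightarrow> measure P A - measure N A = E A x \<bullet> z"
proof -
  obtain Y where Y: "Y \<in> \<A>" "\<forall>A\<in>\<A>. A \<subseteq> Y \<longrightarrow> 0 \<le> E A x \<bullet> z"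
    "\<forall>A\<in>\<A>. A \<inter> Y = {} \<longrightarrow> E A x \<bullet> z \<le> 0"
    using E_Hahn_decomposition[of x z] by blast
  interpret pos: finite_signed_measure \<Omega> \<A> "\<lambda>M. E M x \<bullet> z"
    by (rule E_signed_measure)
  interpret neg: finite_signed_measure \<Omega> \<A> "\<lambda>M. - (E M x \<bullet> z)"
    using E_signed_measure[of x "- z"] by simp
  note P = pos.pos_variation_Hahn[OF Y]
  have Y': "\<Omega> - Y \<in> \<A>" "\<forall>A\<in>\<A>. A \<subseteq> \<Omega> - Y \<longrightarrow> 0 \<le> - (E A x \<bullet> z)"
    "\<forall>A\<in>\<A>. A \<inter> (\<Omega> - Y) = {} \<longrightarrow> - (E A x \<bullet> z) \<le> 0"
  proof -
    show "\<Omega> - Y \<in> \<A>"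
      using Y(1) by auto
    have "A \<inter> Y = {}" if "A \<subseteq> \<Omega> - Y" for A
      using that by blast
    then show "\<forall>A\<in>\<A>. A \<subseteq> \<Omega> - Y \<longrightarrow> 0 \<le> - (E A x \<bullet> z)"
      using Y(3) by simp
    have "A \<subseteq> Y" if "A \<in> \<A>" "A \<inter> (\<Omega> - Y) = {}" for A
      using sets_into_space[OF that(1)] that(2) by blast
    then show "\<forall>A\<in>\<A>. A \<inter> (\<Omega> - Y) = {} \<longrightarrow> - (E A x \<bullet> z) \<le> 0"
      using Y(2) by simp
  qed
  note N = neg.pos_variation_Hahn[OF Y']
  show "sets P = \<A>" "finite_measure P"
    unfolding P_def by (rule P)+
  show "sets N = \<A>" "finite_measure N"
    unfolding N_def by (rule N)+
  show "measure P A - measure N A = E A x \<bullet> z" if "A \<in> \<A>" for A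
  proof -
    have "A \<inter> (\<Omega> - Y) = A - Y"
      using sets_into_space[OF that] by auto
    then show ?thesis
      unfolding P_def N_def using P(3)[OF that] N(3)[OF that] pos.split[OF that Y(1)] by simp
  qed
qed

lemma integral_approximates:
  fixes u :: "'n clifford \<Rightarrow> real"
  assumes F: "approximates F f" and M: "finite_measure M" "sets M = \<A>" and u: "bounded_linear u"
  shows "(\<lambda>k. \<Sum>c\<in>F k ` \<Omega>. u c * measure M (F k -` {c} \<inter> \<Omega>)) \<longlonglongrightarrow> (\<integral>w. u (f w) \<partial>M)"
proof -
  interpret M: finite_measure M
    by fact
  have sp: "space M = \<Omega>"
    using sets_eq_imp_space_eq[of M "sigma \<Omega> \<A>"] M(2) by simp
  have simple: "simple_function M (F k)" for k
    using approximatesD(1)[OF F] M(2) sp by (simp add: simple_function_def)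
  have "(\<lambda>k. \<integral>w. u (F k w) \<partial>M) \<longlonglongrightarrow> (\<integral>w. u (f w) \<partial>M)"
    using approximatesD(3)[OF F] M.integral_simple_compose(1)[OF simple]
    by (intro M.integral_uniform_limit bounded_linear.uniform_limit[OF u]) (simp_all add: sp)
  then show ?thesis
    by (simp add: M.integral_simple_compose(2)[OF simple] sp)
qed

text \<open>Only the differences of the measures matter, so they are left arbitrary: the Jordan
  parts give the inner product formula, while the norm formula takes the diagonal measure and the
  null measure for the real part.\<close>

lemma spectral_int_inner:
  assumes F: "approximates F f"
    and P: "finite_measure P" "sets P = \<A>" and N: "finite_measure N" "sets N = \<A>"
    and PN: "\<And>A. A \<in> \<A> \<Longrightarrow> measure P A - measure N A = E A x \<bullet> z"
    and P': "finite_measure P'" "sets P' = \<A>" and N': "finite_measure N'" "sets N' = \<A>"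
    and PN': "\<And>A. A \<in> \<A> \<Longrightarrow> measure P' A - measure N' A = E A (J x) \<bullet> z"
  shows "spectral_int f x \<bullet> z =
    ((\<integral>w. cre (f w) \<partial>P) - (\<integral>w. cre (f w) \<partial>N)) +
    ((\<integral>w. cim \<II> (f w) \<partial>P') - (\<integral>w. cim \<II> (f w) \<partial>N'))"
proof (rule LIMSEQ_unique)
  show "(\<lambda>k. SI (F k) x \<bullet> z) \<longlonglongrightarrow> spectral_int f x \<bullet> z"
    by (intro tendsto_intros tendsto_apply F)
  define S where "S u M k = (\<Sum>c\<in>F k ` \<Omega>. u c * measure M (F k -` {c} \<inter> \<Omega>))" for u M k
  have cim_integral: "(\<integral>w. f w \<bullet> \<II> \<partial>M) = (\<integral>w. cim \<II> (f w) \<partial>M)" if "sets M = \<A>" for M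
  proof (intro Bochner_Integration.integral_cong refl)
    fix w
    assume "w \<in> space M"
    then have "w \<in> \<Omega>"
      using sets_eq_imp_space_eq[of M "sigma \<Omega> \<A>"] that by simp
    then show "f w \<bullet> \<II> = cim \<II> (f w)"
      using cim_eq_inner[OF \<II> approximates_mem[OF F]] by simp
  qed
  have "SI (F k) x \<bullet> z = (S cre P k - S cre N k) + (S (\<lambda>c. c \<bullet> \<II>) P' k - S (\<lambda>c. c \<bullet> \<II>) N' k)" for k
  proof -
    note simple = approximatesD(1)[OF F, of k]
    note sets = simpleD(2)[OF simple]
    have "(\<Sum>c\<in>F k ` \<Omega>. cre c * (E (F k -` {c} \<inter> \<Omega>) x \<bullet> z)) = S cre P k - S cre N k"
      unfolding S_def sum_subtractf[symmetric]
      by (intro sum.cong refl) (simp add: PN[OF sets, symmetric] right_diff_distrib)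
    moreover have "(\<Sum>c\<in>F k ` \<Omega>. cim \<II> c * (E (F k -` {c} \<inter> \<Omega>) (J x) \<bullet> z))
        = S (\<lambda>c. c \<bullet> \<II>) P' k - S (\<lambda>c. c \<bullet> \<II>) N' k"
      unfolding S_def sum_subtractf[symmetric]
    proof (intro sum.cong refl)
      fix c
      assume "c \<in> F k ` \<Omega>"
      then have "c \<in> cplane \<II>"
        using approximatesD(2)[OF F] by blast
      then show "cim \<II> c * (E (F k -` {c} \<inter> \<Omega>) (J x) \<bullet> z) =
          c \<bullet> \<II> * measure P' (F k -` {c} \<inter> \<Omega>) - c \<bullet> \<II> * measure N' (F k -` {c} \<inter> \<Omega>)"
        by (simp add: PN'[OF sets, symmetric] right_diff_distrib cim_eq_inner[OF \<II>])
    qed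
    ultimately show ?thesis
      by (simp add: SI_inner[OF simple])
  qed
  moreover have "(\<lambda>k. (S cre P k - S cre N k) + (S (\<lambda>c. c \<bullet> \<II>) P' k - S (\<lambda>c. c \<bullet> \<II>) N' k)) \<longlonglongrightarrow>
    ((\<integral>w. cre (f w) \<partial>P) - (\<integral>w. cre (f w) \<partial>N)) +
    ((\<integral>w. f w \<bullet> \<II> \<partial>P') - (\<integral>w. f w \<bullet> \<II> \<partial>N'))"
    unfolding S_def
    by (intro tendsto_intros integral_approximates[OF F] P N P' N' bounded_linear_cre bounded_linear_inner_left)
  ultimately show "(\<lambda>k. SI (F k) x \<bullet> z) \<longlonglongrightarrow>
    ((\<integral>w. cre (f w) \<partial>P) - (\<integral>w. cre (f w) \<partial>N)) +
    ((\<integral>w. cim \<II> (f w) \<partial>P') - (\<integral>w. cim \<II> (f w) \<partial>N'))"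
    by (simp add: cim_integral P' N')
qed

lemma cinner_spectral_int:
  assumes F: "approximates F f"
  shows "cinner (spectral_int f x) y =
    clifford_integral \<Omega> \<A> (\<lambda>M. cinner (E M x) y) (\<lambda>w. cre (f w)) +
    clifford_integral \<Omega> \<A> (\<lambda>M. cinner (J (E M x)) y) (\<lambda>w. cim \<II> (f w))"
proof (rule clifford_eqI)
  fix \<alpha>
  \<comment> \<open>Absorbs the sign and the basis element into one vector independent of
    \<open>v\<close>, so that the \<alpha>-component becomes a plain real inner product.\<close>
  define z where "z = reorder_sign \<alpha> \<alpha> *\<^sub>R rmult y (cconj (basis_elem \<alpha>))"
  have z: "coeff (cinner v y) \<alpha> = v \<bullet> z" for v
    by (simp add: coeff_cinner inner_rmult_left z_def)
  have "signed_integral \<Omega> \<A> (\<lambda>M. J (E M x) \<bullet> z) h = signed_integral \<Omega> \<A> (\<lambda>M. E M (J x) \<bullet> z) h" for h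
    by (rule signed_integral_cong) (simp add: E_J)
  then show "coeff (cinner (spectral_int f x) y) \<alpha> =
      coeff (clifford_integral \<Omega> \<A> (\<lambda>M. cinner (E M x) y) (\<lambda>w. cre (f w)) +
        clifford_integral \<Omega> \<A> (\<lambda>M. cinner (J (E M x)) y) (\<lambda>w. cim \<II> (f w))) \<alpha>"
    unfolding clifford_integral_def z coeff_simps coeff_Clifford
    using spectral_int_inner[OF F E_Jordan_decomposition(3,1,4,2,5) E_Jordan_decomposition(3,1,4,2,5), of x z]
    by (simp add: signed_integral_def)
qed

section \<open>The norm formula, the norm bound and dominated convergence\<close>

lemma norm_spectral_int:
  assumes F: "approximates F f"
  shows "(norm (spectral_int f x))\<^sup>2 = (\<integral>w. (norm (f w))\<^sup>2 \<partial>diag_measure x)"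
proof -
  define h where "h w = cconj (f w) * f w" for w
  obtain H where H: "approximates H h"
    unfolding h_def using approximates_mult[OF approximates_cconj[OF F] F] by blast
  have h: "cre (h w) = (norm (f w))\<^sup>2" "cim \<II> (h w) = 0" if "w \<in> \<Omega>" for w
    using cconj_mult_self[OF \<II> approximates_mem[OF F that]] cplane_scaleR_one[OF \<II>] by (simp_all add: h_def)
  have "(norm (spectral_int f x))\<^sup>2 = spectral_int h x \<bullet> x"
    unfolding h_def spectral_int_mult[OF approximates_cconj[OF F] F] power2_norm_eq_inner
    by (simp add: spectral_int_cconj_inner[OF F] inner_commute)
  \<comment> \<open>The diagonal measure is already positive, so the null measure serves as its
    negative part. The imaginary part of \<open>h\<close> vanishes on \<Omega>, which removes the
    second pair.\<close>
  also have "\<dots> = (\<integral>w. cre (h w) \<partial>diag_measure x) - (\<integral>w. cre (h w) \<partial>null_measure (sigma \<Omega> \<A>)) +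
      ((\<integral>w. cim \<II> (h w) \<partial>pos_variation \<Omega> \<A> (\<lambda>M. E M (J x) \<bullet> x)) -
       (\<integral>w. cim \<II> (h w) \<partial>pos_variation \<Omega> \<A> (\<lambda>M. - (E M (J x) \<bullet> x))))"
    by (intro spectral_int_inner[OF H] E_Jordan_decomposition finite_diag_measure)
      (auto simp: measure_diag_measure intro!: finite_measureI)
  also have "\<dots> = (\<integral>w. (norm (f w))\<^sup>2 \<partial>diag_measure x)"
  proof -
    have "space (pos_variation \<Omega> \<A> \<nu>) = \<Omega>" for \<nu>
      by (simp add: pos_variation_def)
    then have "(\<integral>w. cim \<II> (h w) \<partial>pos_variation \<Omega> \<A> \<nu>) = 0" for \<nu>
      using Bochner_Integration.integral_cong[of "pos_variation \<Omega> \<A> \<nu>" _ "\<lambda>w. cim \<II> (h w)" "\<lambda>_. 0"] h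
      by simp
    moreover have "(\<integral>w. cre (h w) \<partial>diag_measure x) = (\<integral>w. (norm (f w))\<^sup>2 \<partial>diag_measure x)"
      using h by (intro Bochner_Integration.integral_cong) simp_all
    moreover have "(\<integral>w. cre (h w) \<partial>null_measure (sigma \<Omega> \<A>)) = 0"
      by (intro integral_eq_zero_AE AE_I[of _ _ \<Omega>]) auto
    ultimately show ?thesis
      by simp
  qed
  finally show ?thesis .
qed

lemma bounded_measurable_sigmaD:
  assumes "f \<in> bounded_measurable \<Omega> \<A> \<II>"
  shows "f \<in> borel_measurable (diag_measure x)"
proof -
  have "borel_measurable (diag_measure x) = borel_measurable (sigma \<Omega> \<A>)"
    by (rule measurable_cong_sets) simp_all
  then show ?thesis
    using assms unfolding bounded_measurable_def by blast
qed

lemma norm_spectral_int_le: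
  assumes f: "f \<in> bounded_measurable \<Omega> \<A> \<II>"
  shows "norm (spectral_int f) \<le> sup_norm \<Omega> f"
proof -
  obtain F where F: "approximates F f"
    using bounded_measurable_approximates[OF f] .
  have bdd: "bdd_above (insert 0 ((\<lambda>w. norm (f w)) ` \<Omega>))"
    using approximates_bounded[OF F] by (auto simp: bounded_iff intro: bdd_aboveI2)
  have sup: "norm (f w) \<le> sup_norm \<Omega> f" if "w \<in> \<Omega>" for w
    unfolding sup_norm_def using that bdd by (intro cSup_upper) auto
  have nonneg: "0 \<le> sup_norm \<Omega> f"
    unfolding sup_norm_def using bdd by (intro cSup_upper) auto
  show ?thesis
  proof (rule norm_blinfun_bound[OF nonneg])
    fix x
    interpret finite_measure "diag_measure x"
      by (rule finite_diag_measure)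
    have le: "(norm (f w))\<^sup>2 \<le> (sup_norm \<Omega> f)\<^sup>2" if "w \<in> \<Omega>" for w
      using sup[OF that] by (intro power_mono) auto
    have "integrable (diag_measure x) (\<lambda>w. (norm (f w))\<^sup>2)"
      using bounded_measurable_sigmaD[OF f, of x] le
      by (intro integrable_const_bound[of _ "(sup_norm \<Omega> f)\<^sup>2"]) (auto intro!: AE_I2)
    then have "(norm (spectral_int f x))\<^sup>2 \<le> (\<integral>w. (sup_norm \<Omega> f)\<^sup>2 \<partial>diag_measure x)"
      unfolding norm_spectral_int[OF F] using le by (intro integral_mono) auto
    also have "\<dots> = (sup_norm \<Omega> f * norm x)\<^sup>2"
      by (simp add: measure_diag_measure E_space power2_norm_eq_inner power_mult_distrib)
    finally show "norm (spectral_int f x) \<le> sup_norm \<Omega> f * norm x"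
      using nonneg by (simp add: power2_le_iff_abs_le)
  qed
qed

text \<open>By linearity and the norm formula, the squared distance of the two vectors is the
  integral of |F j - f|^2 against a finite measure.\<close>

lemma spectral_int_dominated_convergence:
  assumes f: "f \<in> bounded_measurable \<Omega> \<A> \<II>" and F: "\<And>j. F j \<in> bounded_measurable \<Omega> \<A> \<II>"
    and N: "N \<in> \<A>" "E N = 0" "\<And>w. w \<in> \<Omega> - N \<Longrightarrow> (\<lambda>j. F j w) \<longlonglongrightarrow> f w"
    and \<kappa>: "\<And>j w. w \<in> \<Omega> \<Longrightarrow> norm (F j w) \<le> \<kappa>"
  shows "(\<lambda>j. spectral_int (F j) x) \<longlonglongrightarrow> spectral_int f x"
proof -
  interpret finite_measure "diag_measure x"
    by (rule finite_diag_measure)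
  obtain G where G: "approximates G f"
    using bounded_measurable_approximates[OF f] .
  have "\<exists>H. approximates H (F j)" for j
    using bounded_measurable_approximates[OF F] by blast
  then obtain H where H: "\<And>j. approximates (H j) (F j)"
    by metis
  obtain B where B: "\<And>w. w \<in> \<Omega> \<Longrightarrow> norm (f w) \<le> B"
    using approximates_bounded[OF G] by (auto simp: bounded_iff)
  note [measurable] = bounded_measurable_sigmaD[OF f, of x] bounded_measurable_sigmaD[OF F, where x = x]
  have "(\<lambda>j. \<integral>w. (norm (F j w - f w))\<^sup>2 \<partial>diag_measure x) \<longlonglongrightarrow> (\<integral>w. 0 \<partial>diag_measure x)"
  \<comment> \<open>\<kappa> bounds the sequence only; on \<open>N\<close> the function
    \<open>f\<close> is unrelated to it and needs its own bound \<open>B\<close>.\<close>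
  proof (rule integral_dominated_convergence[where w = "\<lambda>_. (\<kappa> + B)\<^sup>2"])
    have "emeasure (diag_measure x) N = 0"
      using N by (simp add: emeasure_diag_measure)
    then have "N \<in> null_sets (diag_measure x)"
      using N(1) by (simp add: null_sets_def)
    then show "AE w in diag_measure x. (\<lambda>j. (norm (F j w - f w))\<^sup>2) \<longlonglongrightarrow> 0"
    proof (rule AE_I')
      show "{w \<in> space (diag_measure x). \<not> (\<lambda>j. (norm (F j w - f w))\<^sup>2) \<longlonglongrightarrow> 0} \<subseteq> N"
      proof safe
        fix w
        assume "w \<in> space (diag_measure x)" "\<not> (\<lambda>j. (norm (F j w - f w))\<^sup>2) \<longlonglongrightarrow> 0"
        moreover have "(\<lambda>j. (norm (F j w - f w))\<^sup>2) \<longlonglongrightarrow> (norm (f w - f w))\<^sup>2" if "w \<in> \<Omega> - N"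
          by (intro tendsto_intros N(3) that)
        ultimately show "w \<in> N"
          by auto
      qed
    qed
    show "AE w in diag_measure x. norm ((norm (F j w - f w))\<^sup>2) \<le> (\<kappa> + B)\<^sup>2" for j
    proof (rule AE_I2)
      fix w
      assume "w \<in> space (diag_measure x)"
      then have "norm (F j w - f w) \<le> \<kappa> + B"
        using \<kappa>[of w j] B[of w] norm_triangle_ineq4[of "F j w" "f w"] by simp
      then show "norm ((norm (F j w - f w))\<^sup>2) \<le> (\<kappa> + B)\<^sup>2"
        by (simp add: power_mono)
    qed
  qed simp_all
  then have "(\<lambda>j. (norm (spectral_int (F j) x - spectral_int f x))\<^sup>2) \<longlonglongrightarrow> 0"
    using norm_spectral_int[OF approximates_diff[OF H G], where x = x]
    by (simp add: spectral_int_diff[OF H G] blinfun.diff_left)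
  then have "(\<lambda>j. sqrt ((norm (spectral_int (F j) x - spectral_int f x))\<^sup>2)) \<longlonglongrightarrow> sqrt 0"
    by (rule tendsto_real_sqrt)
  then show ?thesis
    by (simp add: tendsto_norm_zero_iff LIM_zero_iff)
qed

end

theorem theorem5p2p4:
  fixes E :: "'w set \<Rightarrow> ('h::{real_inner,complete_space}, 'n::{finite,linorder}) coperator"
    and J :: "('h, 'n) coperator"
    and \<II> :: "'n clifford"
    and f g :: "'w \<Rightarrow> 'n clifford"
  assumes "spectral_measure \<Omega> \<A> E"
    and "imaginary_op J"
    and "associated \<A> E J"
    and "\<II> \<in> imag_sphere"
    and "f \<in> bounded_measurable \<Omega> \<A> \<II>"
    and "g \<in> bounded_measurable \<Omega> \<A> \<II>"
  shows "let \<I> = spectral_integral \<Omega> \<A> E J \<II> in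
    \<I> (\<lambda>w. cconj (f w)) = adj (\<I> f) \<and>
    \<I> (\<lambda>w. f w * g w) = \<I> f o\<^sub>L \<I> g \<and>
    \<I> (\<lambda>w. \<II>) = J \<and>
    (\<forall>c \<in> cplane \<II>.
      \<I> (\<lambda>w. c * f w + g w) = ((cre c *\<^sub>R id_blinfun + cim \<II> c *\<^sub>R J) o\<^sub>L \<I> f) + \<I> g) \<and>
    (\<forall>x y. cinner (\<I> f x) y =
      clifford_integral \<Omega> \<A> (\<lambda>M. cinner (E M x) y) (\<lambda>w. cre (f w)) +
      clifford_integral \<Omega> \<A> (\<lambda>M. cinner (J (E M x)) y) (\<lambda>w. cim \<II> (f w))) \<and>
    (\<forall>x. (norm (\<I> f x))\<^sup>2 =
      (\<integral>w. (norm (f w))\<^sup>2 \<partial>measure_of \<Omega> \<A> (\<lambda>M. ennreal (cre (cinner (E M x) x))))) \<and>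
    norm (\<I> f) \<le> sup_norm \<Omega> f \<and>
    (\<forall>(F :: nat \<Rightarrow> 'w \<Rightarrow> 'n clifford) \<kappa>.
      (\<forall>j. F j \<in> bounded_measurable \<Omega> \<A> \<II>) \<longrightarrow>
      (\<exists>N\<in>\<A>. E N = 0 \<and> (\<forall>w\<in>\<Omega> - N. (\<lambda>j. F j w) \<longlonglongrightarrow> f w)) \<longrightarrow>
      \<kappa> > 0 \<longrightarrow> (\<forall>j. \<forall>w\<in>\<Omega>. norm (F j w) \<le> \<kappa>) \<longrightarrow>
      (\<forall>x. (\<lambda>j. \<I> (F j) x) \<longlonglongrightarrow> \<I> f x))"
proof -
  interpret spectral_calculus \<Omega> \<A> E J \<II>
    using assms by unfold_locales
  obtain F where F: "approximates F f"
    using bounded_measurable_approximates[OF assms(5)] .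
  obtain G where G: "approximates G g"
    using bounded_measurable_approximates[OF assms(6)] .
  \<comment> \<open>The scalar \<open>c\<close> is treated as a constant function with integral
    \<open>scalar_op c\<close>, reducing linearity over the plane to multiplicativity and
    additivity.\<close>
  have "spectral_int (\<lambda>w. c * f w + g w)
      = ((cre c *\<^sub>R id_blinfun + cim \<II> c *\<^sub>R J) o\<^sub>L spectral_int f) + spectral_int g"
    if "c \<in> cplane \<II>" for c
    using spectral_int_add[OF approximates_mult[OF approximates_const[OF that] F] G]
      spectral_int_mult[OF approximates_const[OF that] F] spectral_int_const[OF that]
    by (simp add: scalar_op_def)
  moreover have "spectral_int (\<lambda>w. \<II>) = J"
    using cplane_imag[OF \<II>] spectral_int_const[of \<II>] by (simp add: scalar_op_def)
  moreover have "(norm (spectral_int f x))\<^sup>2 =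
      (\<integral>w. (norm (f w))\<^sup>2 \<partial>measure_of \<Omega> \<A> (\<lambda>M. ennreal (cre (cinner (E M x) x))))" for x
    using norm_spectral_int[OF F] by (simp add: diag_measure_def cre_cinner)
  ultimately show ?thesis
    unfolding Let_def
    using spectral_int_adj[OF F] spectral_int_mult[OF F G] cinner_spectral_int[OF F]
      norm_spectral_int_le[OF assms(5)] spectral_int_dominated_convergence[OF assms(5)]
    by (intro conjI ballI allI impI) (blast+)
qed

end
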